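(* There is a unitary $v \in \mathcal{O}_2$ such that $\lambda_v(\mathcal{F}_2) \subseteq \mathcal{F}_2$ but $v \notin \mathcal{F}_2$.
   Context: $\mathcal{O}_2$ is the Cuntz algebra, the (simple, unital) universal $C^*$-algebra generated by isometries $S_1,S_2$ with $S_1S_1^*+S_2S_2^*=1$. $\mathcal{F}_2\subseteq\mathcal{O}_2$ is the canonical UHF-subalgebra of type $2^\infty$: the closed linear span of all $S_{i_1}\cdots S_{i_k}S_{j_k}^*\cdots S_{j_1}^*$ with $k\ge 0$ and all indices in $\{1,2\}$. For a unitary $v\in\mathcal{O}_2$, $\lambda_v$ is the unital $*$-endomorphism of $\mathcal{O}_2$ determined by $\lambda_v(S_j)=vS_j$, $j=1,2$. *)

theory Defs
  imports "HOL-Analysis.Analysis" "HOL-Library.Poly_Mapping"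
begin

section \<open>Unital C*-algebras\<close>

class scaleC =
  fixes scaleC :: "complex \<Rightarrow> 'a \<Rightarrow> 'a"  (infixr "*\<^sub>C" 75)

class star =
  fixes star :: "'a \<Rightarrow> 'a"

text \<open>Unital, nonzero C*-algebras: the superclass \<^class>\<open>real_normed_algebra_1\<close> provides
  submultiplicativity of the norm and \<^term>\<open>norm 1 = 1\<close>.\<close>

class cstar_algebra_1 = real_normed_algebra_1 + banach + scaleC + star +
  assumes scaleC_add_right: "c *\<^sub>C (x + y) = c *\<^sub>C x + c *\<^sub>C y"
    and scaleC_add_left: "(c + d) *\<^sub>C x = c *\<^sub>C x + d *\<^sub>C x"
    and scaleC_scaleC: "c *\<^sub>C d *\<^sub>C x = (c * d) *\<^sub>C x"
    and scaleR_scaleC: "r *\<^sub>R x = complex_of_real r *\<^sub>C x"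
    and mult_scaleC_left: "(c *\<^sub>C x) * y = c *\<^sub>C (x * y)"
    and mult_scaleC_right: "x * (c *\<^sub>C y) = c *\<^sub>C (x * y)"
    and norm_scaleC: "norm (c *\<^sub>C x) = cmod c * norm x"
    and star_star: "star (star x) = x"
    and star_add: "star (x + y) = star x + star y"
    and star_scaleC: "star (c *\<^sub>C x) = cnj c *\<^sub>C star x"
    and star_mult: "star (x * y) = star y * star x"
    and cstar_identity: "norm (star x * x) = (norm x)\<^sup>2"

lemma scaleC_one: "1 *\<^sub>C x = (x::'a::cstar_algebra_1)"
  using scaleR_scaleC[of 1 x] by simp

lemma vector_space_scaleC: "vector_space (scaleC :: complex \<Rightarrow> 'a::cstar_algebra_1 \<Rightarrow> 'a)"
  by unfold_locales (simp_all add: scaleC_add_right scaleC_add_left scaleC_scaleC scaleC_one)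

lemma scaleC_zero_left [simp]: "0 *\<^sub>C x = (0::'a::cstar_algebra_1)"
  using scaleR_scaleC[of 0 x] by simp

lemma scaleC_zero_right [simp]: "c *\<^sub>C (0::'a::cstar_algebra_1) = 0"
  using scaleC_add_right[of c 0 "0::'a"] by simp

lemma star_zero [simp]: "star (0::'a::cstar_algebra_1) = 0"
  using star_add[of 0 "0::'a"] by simp

lemma star_one [simp]: "star (1::'a::cstar_algebra_1) = 1"
  by (metis mult.left_neutral mult.right_neutral star_mult star_star)

lemma star_minus: "star (- x) = - star (x::'a::cstar_algebra_1)"
  by (metis add.right_inverse add_eq_0_iff star_add star_zero)

lemma star_diff: "star (x - y) = star x - star (y::'a::cstar_algebra_1)"
  by (metis diff_conv_add_uminus star_add star_minus)

lemma star_scaleR: "star (r *\<^sub>R x) = r *\<^sub>R star (x::'a::cstar_algebra_1)"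
  by (simp add: scaleR_scaleC star_scaleC)

lemma norm_star [simp]: "norm (star x) = norm (x::'a::cstar_algebra_1)"
proof -
  have le: "norm y \<le> norm (star y)" for y :: 'a
  proof (cases "norm y = 0")
    case False
    have "norm y * norm y \<le> norm (star y) * norm y"
      using norm_mult_ineq[of "star y" y] by (simp add: cstar_identity power2_eq_square)
    then show ?thesis using False by (simp add: mult_le_cancel_right)
  qed simp
  from le[of x] le[of "star x"] show ?thesis by (simp add: star_star)
qed

lemma bounded_linear_star: "bounded_linear (star :: 'a::cstar_algebra_1 \<Rightarrow> 'a)"
  by (rule bounded_linear_intro[where K=1]) (simp_all add: star_add star_scaleR)

definition isometry_elt :: "'a::cstar_algebra_1 \<Rightarrow> bool" where
  "isometry_elt s \<longleftrightarrow> star s * s = 1"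

definition unitary_elt :: "'a::cstar_algebra_1 \<Rightarrow> bool" where
  "unitary_elt v \<longleftrightarrow> star v * v = 1 \<and> v * star v = 1"

text \<open>Unital *-homomorphisms; continuity is automatic (lemma \<open>unital_star_hom_norm_le\<close>).\<close>

definition unital_star_hom :: "('a::cstar_algebra_1 \<Rightarrow> 'b::cstar_algebra_1) \<Rightarrow> bool" where
  "unital_star_hom \<phi> \<longleftrightarrow>
     (\<forall>x y. \<phi> (x + y) = \<phi> x + \<phi> y) \<and> (\<forall>c x. \<phi> (c *\<^sub>C x) = c *\<^sub>C \<phi> x) \<and>
     (\<forall>x y. \<phi> (x * y) = \<phi> x * \<phi> y) \<and> (\<forall>x. \<phi> (star x) = star (\<phi> x)) \<and> \<phi> 1 = 1"

lemma sqrt_one_minus_ex: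
  fixes w :: "'a::cstar_algebra_1"
  assumes "norm w < 1" "star w = w"
  shows "\<exists>b. star b = b \<and> b * b = 1 - w \<and> (\<forall>a. a * w = w * a \<longrightarrow> a * b = b * a)"
proof -
  define c :: "nat \<Rightarrow> real" where "c n = ((1/2) gchoose n) * (-1)^n" for n
  define t where "t n = c n *\<^sub>R w ^ n" for n
  obtain r where r: "norm w < r" "r < 1" using assms(1) dense by blast
  have r0: "0 \<le> r" using r(1) norm_ge_zero[of w] by linarith
  have "summable (\<lambda>n. ((1/2::real) gchoose n) * (-r)^n)"
    using gen_binomial_real[of "-r" "1/2"] r r0 by (auto simp: sums_iff)
  moreover have "((1/2::real) gchoose n) * (-r)^n = c n * r^n" for n
    by (simp add: c_def power_minus[of r])
  ultimately have "summable (\<lambda>n. c n * r^n)" by simp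
  then have "summable (\<lambda>n. norm (c n * (norm w)^n))"
    by (rule powser_insidea) (use r r0 in auto)
  then have sn: "summable (\<lambda>n. norm (t n))"
  proof (rule summable_comparison_test'[where N=0])
    fix n show "norm (norm (t n)) \<le> norm (c n * norm w ^ n)"
      by (auto simp: t_def abs_mult intro!: mult_left_mono norm_power_ineq)
  qed
  then have st: "summable t" by (rule summable_norm_cancel)
  define b where "b = suminf t"
  have coef: "(\<Sum>i\<le>k. c i * c (k - i)) = (if k = 0 then 1 else if k = 1 then -1 else 0)" for k
  proof -
    have "(\<Sum>i\<le>k. c i * c (k - i)) = (\<Sum>i\<le>k. ((1/2) gchoose i) * ((1/2) gchoose (k - i)) * (-1)^k)"
    proof (rule sum.cong)
      fix i assume "i \<in> {..k}"
      then have e: "(-1::real)^k = (-1)^i * (-1)^(k-i)" by (simp flip: power_add)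
      show "c i * c (k - i) = ((1/2) gchoose i) * ((1/2) gchoose (k - i)) * (-1)^k"
        unfolding c_def e by (simp only: mult_ac)
    qed simp
    also have "\<dots> = ((1::real) gchoose k) * (-1)^k"
      using gbinomial_Vandermonde[of "1/2::real" "1/2" k]
      by (simp add: atMost_atLeast0 flip: sum_distrib_right)
    also have "((1::real) gchoose k) = of_nat (1 choose k)"
      by (metis binomial_gbinomial of_nat_1)
    also have "of_nat (1 choose k) * (-1)^k = (if k = 0 then 1 else if k = 1 then -1 else (0::real))"
      by (cases k) (auto simp: binomial_eq_0)
    finally show ?thesis .
  qed
  have "(\<lambda>k. \<Sum>i\<le>k. t i * t (k - i)) sums (b * b)"
    unfolding b_def by (rule Cauchy_product_sums[OF sn sn])
  moreover have "(\<Sum>i\<le>k. t i * t (k - i)) = (\<Sum>i\<le>k. c i * c (k - i)) *\<^sub>R w ^ k" for k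
    unfolding t_def scaleR_sum_left by (rule sum.cong) (auto simp flip: power_add)
  ultimately have s1: "(\<lambda>k. (if k = 0 then 1 else if k = 1 then -1 else 0) *\<^sub>R w ^ k) sums (b * b)"
    by (simp add: coef)
  have "(\<lambda>k. (if k = 0 then 1 else if k = 1 then -1 else 0) *\<^sub>R w ^ k) sums
        (\<Sum>k\<in>{0,1}. (if k = 0 then 1 else if k = 1 then -1 else 0) *\<^sub>R w ^ k)"
    by (rule sums_finite) auto
  with s1 have bb: "b * b = 1 - w"
    using sums_unique2 by fastforce
  have "star b = b"
  proof -
    have p: "star (w ^ n) = w ^ n" for n
      by (induction n) (simp_all add: star_mult assms(2) power_commutes)
    have "star b = suminf (\<lambda>n. star (t n))"
      unfolding b_def by (rule bounded_linear.suminf[OF bounded_linear_star st])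
    also have "(\<lambda>n. star (t n)) = t" by (simp add: t_def star_scaleR p fun_eq_iff)
    finally have "star b = suminf t" .
    also have "\<dots> = b" by (simp add: b_def)
    finally show ?thesis .
  qed
  moreover have "a * b = b * a" if "a * w = w * a" for a
  proof -
    have p: "a * w ^ n = w ^ n * a" for n
      by (induction n) (simp_all add: that mult.assoc, metis that mult.assoc)
    have "a * b = suminf (\<lambda>n. a * t n)" unfolding b_def by (rule suminf_mult[OF st, symmetric])
    also have "\<dots> = suminf (\<lambda>n. t n * a)" by (simp add: t_def p)
    also have "\<dots> = b * a" unfolding b_def by (rule suminf_mult2[OF st, symmetric])
    finally show ?thesis .
  qed
  ultimately show ?thesis using bb by blast
qed

lemma unital_star_hom_norm_le:
  fixes \<phi> :: "'a::cstar_algebra_1 \<Rightarrow> 'b::cstar_algebra_1"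
  assumes "unital_star_hom \<phi>"
  shows "norm (\<phi> x) \<le> norm x"
proof -
  have add: "\<phi> (x + y) = \<phi> x + \<phi> y" and sc: "\<phi> (c *\<^sub>C x) = c *\<^sub>C \<phi> x" and
    mul: "\<phi> (x * y) = \<phi> x * \<phi> y" and st: "\<phi> (star x) = star (\<phi> x)" and one: "\<phi> 1 = 1" for x y c
    using assms by (auto simp: unital_star_hom_def)
  have scR: "\<phi> (r *\<^sub>R x) = r *\<^sub>R \<phi> x" for r x by (simp add: scaleR_scaleC sc)
  have sa1: "norm (\<phi> a) \<le> 1" if a: "star a = a" "norm a < 1" for a
  proof -
    have "norm (a * a) < 1"
      using cstar_identity[of a] a by (simp add: power_less_one_iff)
    then obtain b where b: "star b = b" "b * b = 1 - a * a" "a * b = b * a"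
      using sqrt_one_minus_ex[of "a * a"] by (auto simp: star_mult a mult.assoc)
    define u where "u = a + \<i> *\<^sub>C b"
    have su: "star u = a + (-\<i>) *\<^sub>C b" by (simp add: u_def star_add star_scaleC a b)
    have "star u * u = a * a + b * b + (\<i> *\<^sub>C (a * b) + (-\<i>) *\<^sub>C (b * a))"
      unfolding su unfolding u_def
      by (simp add: distrib_left distrib_right mult_scaleC_left mult_scaleC_right scaleC_scaleC scaleC_one
          scaleC_add_right algebra_simps)
    also have "\<i> *\<^sub>C (a * b) + (-\<i>) *\<^sub>C (b * a) = 0"
      by (simp add: b(3) flip: scaleC_add_left)
    finally have uu: "star u * u = 1" by (simp add: b)
    have "(norm (\<phi> u))\<^sup>2 = 1"
      using cstar_identity[of "\<phi> u"] uu by (metis mul one norm_one st)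
    then have nu: "norm (\<phi> u) = 1" by (simp add: power2_eq_1_iff) (smt (verit) norm_ge_zero)
    have "u + star u = 2 *\<^sub>R a"
      unfolding su by (simp add: u_def algebra_simps scaleR_2 flip: scaleC_add_left)
    then have "2 *\<^sub>R \<phi> a = \<phi> u + star (\<phi> u)" by (metis add scR st)
    then have "2 * norm (\<phi> a) \<le> norm (\<phi> u) + norm (star (\<phi> u))"
      by (metis abs_numeral norm_scaleR norm_triangle_ineq)
    then show ?thesis by (simp add: nu)
  qed
  have sa: "norm (\<phi> a) \<le> norm a" if a: "star a = a" for a
  proof (rule dense_ge)
    fix r assume r: "norm a < r"
    then have r0: "0 < r" using norm_ge_zero[of a] by linarith
    have "norm (\<phi> ((1/r) *\<^sub>R a)) \<le> 1"
      by (rule sa1) (use r r0 in \<open>auto simp: star_scaleR a\<close>)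
    then show "norm (\<phi> a) \<le> r" using r0 by (simp add: scR field_simps)
  qed
  have "(norm (\<phi> x))\<^sup>2 = norm (\<phi> (star x * x))" by (simp add: mul st cstar_identity)
  also have "\<dots> \<le> norm (star x * x)" by (rule sa) (simp add: star_mult star_star)
  also have "\<dots> = (norm x)\<^sup>2" by (rule cstar_identity)
  finally have "(norm (\<phi> x))\<^sup>2 \<le> (norm x)\<^sup>2" .
  then show ?thesis by (rule power2_le_imp_le) (rule norm_ge_zero)
qed

section \<open>The Cuntz algebra with two generators\<close>

subsection \<open>The free unital *-algebra on two generators\<close>

datatype index = I1 | I2

text \<open>The letters are the formal generators and their formal adjoints. Words form the free
  monoid, written additively because convolution on \<^typ>\<open>'a \<Rightarrow>\<^sub>0 'b\<close> is defined for
  additive monoids \<^typ>\<open>'a\<close>; the product of \<open>free_alg\<close> is thus concatenation of words.\<close>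

datatype letter = Gen index | Adj index

datatype word = Word "letter list"

instantiation word :: monoid_add
begin

definition zero_word :: word where
  "zero_word = Word []"

fun plus_word :: "word \<Rightarrow> word \<Rightarrow> word" where
  "plus_word (Word u) (Word v) = Word (u @ v)"

instance
proof
  fix a b c :: word
  show "a + b + c = a + (b + c)" by (cases a; cases b; cases c) simp
  show "0 + a = a" "a + 0 = a" by (cases a; simp add: zero_word_def)+
qed

end

type_synonym free_alg = "word \<Rightarrow>\<^sub>0 complex"

fun adj_letter :: "letter \<Rightarrow> letter" where
  "adj_letter (Gen i) = Adj i"
| "adj_letter (Adj i) = Gen i"

fun adj_word :: "word \<Rightarrow> word" where
  "adj_word (Word u) = Word (rev (List.map adj_letter u))"

definition gen :: "index \<Rightarrow> free_alg" where
  "gen i = Poly_Mapping.single (Word [Gen i]) 1"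

definition fscale :: "complex \<Rightarrow> free_alg \<Rightarrow> free_alg" where
  "fscale c f = Poly_Mapping.single 0 c * f"

definition fstar :: "free_alg \<Rightarrow> free_alg" where
  "fstar f = Poly_Mapping.map_key adj_word (Poly_Mapping.map cnj f)"

lemma adj_letter_adj_letter [simp]: "adj_letter (adj_letter l) = l"
  by (cases l) simp_all

lemma adj_word_adj_word [simp]: "adj_word (adj_word w) = w"
  by (cases w) (simp add: rev_map o_def)

lemma adj_word_add: "adj_word (v + w) = adj_word w + adj_word v"
  by (cases v; cases w) simp

lemma adj_word_zero [simp]: "adj_word 0 = 0"
  by (simp add: zero_word_def)

lemma inj_adj_word: "inj adj_word"
  by (metis adj_word_adj_word injI)

lemma lookup_fstar [simp]:
  "Poly_Mapping.lookup (fstar f) w = cnj (Poly_Mapping.lookup f (adj_word w))"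
  by (simp add: fstar_def map_key.rep_eq inj_adj_word map.rep_eq when_def)

lemma fstar_add: "fstar (f + g) = fstar f + fstar g"
  by (rule poly_mapping_eqI) (simp add: lookup_add)

lemma fstar_zero [simp]: "fstar 0 = 0"
  by (rule poly_mapping_eqI) simp

lemma fstar_uminus: "fstar (- f) = - fstar f"
  by (rule poly_mapping_eqI) simp

lemma fstar_diff: "fstar (f - g) = fstar f - fstar g"
  by (rule poly_mapping_eqI) (simp add: lookup_minus)

lemma fstar_fstar [simp]: "fstar (fstar f) = f"
  by (rule poly_mapping_eqI) simp

lemma fstar_single [simp]:
  "fstar (Poly_Mapping.single w c) = Poly_Mapping.single (adj_word w) (cnj c)"
  by (rule poly_mapping_eqI) (metis (no_types, lifting) adj_word_adj_word complex_cnj_zero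
      lookup_fstar lookup_single_eq lookup_single_not_eq)

lemma free_induct [case_names zero single add]:
  assumes "P 0" "\<And>w c. P (Poly_Mapping.single w c)" "\<And>f g. P f \<Longrightarrow> P g \<Longrightarrow> P (f + g)"
  shows "P (f :: free_alg)"
proof (induction f rule: update_induct)
  case const
  then show ?case using assms(1) by simp
next
  case (update f a b)
  have "Poly_Mapping.update a b f = f + Poly_Mapping.single a b"
    using update(1) by (intro poly_mapping_eqI)
      (auto simp: lookup_update lookup_add lookup_single when_def in_keys_iff)
  then show ?case using assms update by metis
qed

lemma fstar_mult: "fstar (f * g) = fstar g * fstar f"
proof (induction f rule: free_induct)
  case (single w c)
  show ?case
    by (induction g rule: free_induct)
      (simp_all add: mult_single adj_word_add distrib_left distrib_right fstar_add mult.commute)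
qed (simp_all add: distrib_left distrib_right fstar_add)

lemma fstar_one [simp]: "fstar 1 = 1"
  by (simp flip: single_one)

lemma fscale_central: "f * fscale c g = fscale c (f * g)"
proof -
  have "f * Poly_Mapping.single 0 c = Poly_Mapping.single 0 c * f"
    by (induction f rule: free_induct) (simp_all add: mult_single distrib_left distrib_right mult.commute)
  then show ?thesis by (simp add: fscale_def flip: mult.assoc)
qed

lemma fscale_mult: "fscale c f * g = fscale c (f * g)"
  by (simp add: fscale_def mult.assoc)

lemma fscale_add_right: "fscale c (f + g) = fscale c f + fscale c g"
  by (simp add: fscale_def distrib_left)

lemma fscale_diff_right: "fscale c (f - g) = fscale c f - fscale c g"
  by (simp add: fscale_def right_diff_distrib)

lemma fscale_add_left: "fscale (c + d) f = fscale c f + fscale d f"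
  by (simp add: fscale_def single_add distrib_right)

lemma fscale_fscale: "fscale c (fscale d f) = fscale (c * d) f"
  by (simp add: fscale_def mult_single flip: mult.assoc)

lemma fscale_one [simp]: "fscale 1 f = f"
  by (simp add: fscale_def)

lemma fscale_zero_left [simp]: "fscale 0 f = 0"
  by (simp add: fscale_def)

lemma fscale_minus_one: "fscale (-1) f = - f"
  by (simp add: fscale_def single_uminus)

lemma fstar_fscale: "fstar (fscale c f) = fscale (cnj c) (fstar f)"
  unfolding fscale_def[of c] by (simp add: fstar_mult fscale_central[of _ _ 1, simplified fscale_def, simplified] fscale_def)

lemma fscale_single: "fscale c (Poly_Mapping.single w d) = Poly_Mapping.single w (c * d)"
  by (simp add: fscale_def mult_single)

definition lin :: "(complex \<Rightarrow> 'v \<Rightarrow> 'v) \<Rightarrow> (word \<Rightarrow> 'v) \<Rightarrow> free_alg \<Rightarrow> 'v::comm_monoid_add" where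
  "lin s g f = (\<Sum>w\<in>Poly_Mapping.keys f. s (Poly_Mapping.lookup f w) (g w))"

lemma lin_superset:
  assumes "\<And>v. s 0 v = 0" "finite A" "Poly_Mapping.keys f \<subseteq> A"
  shows "lin s g f = (\<Sum>w\<in>A. s (Poly_Mapping.lookup f w) (g w))"
  unfolding lin_def by (rule sum.mono_neutral_left) (use assms in \<open>auto simp: in_keys_iff\<close>)

lemma lin_add:
  assumes "\<And>v. s 0 v = 0" "\<And>c d v. s (c + d) v = s c v + s d v"
  shows "lin s g (f + h) = lin s g f + lin s g h"
proof -
  let ?A = "Poly_Mapping.keys f \<union> Poly_Mapping.keys h"
  have "lin s g (f + h) = (\<Sum>w\<in>?A. s (Poly_Mapping.lookup (f + h) w) (g w))"
    by (rule lin_superset) (use assms keys_add[of f h] in auto)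
  also have "\<dots> = (\<Sum>w\<in>?A. s (Poly_Mapping.lookup f w) (g w)) + (\<Sum>w\<in>?A. s (Poly_Mapping.lookup h w) (g w))"
    by (simp add: lookup_add assms sum.distrib)
  also have "(\<Sum>w\<in>?A. s (Poly_Mapping.lookup f w) (g w)) = lin s g f"
    by (rule lin_superset[symmetric]) (use assms in auto)
  also have "(\<Sum>w\<in>?A. s (Poly_Mapping.lookup h w) (g w)) = lin s g h"
    by (rule lin_superset[symmetric]) (use assms in auto)
  finally show ?thesis .
qed

lemma lin_zero [simp]: "lin s g 0 = 0"
  by (simp add: lin_def)

lemma lin_single:
  assumes "\<And>v. s 0 v = 0"
  shows "lin s g (Poly_Mapping.single w c) = s c (g w)"
  by (simp add: lin_def assms)

subsection \<open>The universal C*-seminorm\<close>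

text \<open>C*-seminorms on the free *-algebra in which the Cuntz relations hold. They are exactly the
  functions \<open>x \<mapsto> \<parallel>\<pi>(x)\<parallel>\<close> for *-representations \<open>\<pi>\<close> of the relations in C*-algebras,
  so the pointwise supremum below is the norm defining the universal C*-algebra.\<close>

definition cuntz_seminorm :: "(free_alg \<Rightarrow> real) \<Rightarrow> bool" where
  "cuntz_seminorm p \<longleftrightarrow>
     (\<forall>x y. p (x + y) \<le> p x + p y) \<and> (\<forall>c x. p (fscale c x) = cmod c * p x) \<and>
     (\<forall>x y. p (x * y) \<le> p x * p y) \<and> (\<forall>x. p (fstar x * x) = (p x)\<^sup>2) \<and>
     (\<forall>i. p (fstar (gen i) * gen i - 1) = 0) \<and>
     p (gen I1 * fstar (gen I1) + gen I2 * fstar (gen I2) - 1) = 0"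

definition cuntz_norm :: "free_alg \<Rightarrow> real" where
  "cuntz_norm x = (SUP p\<in>{p. cuntz_seminorm p}. p x)"

context
  fixes p assumes p: "cuntz_seminorm p"
begin

lemma csn_add: "p (x + y) \<le> p x + p y"
  and csn_scale: "p (fscale c x) = cmod c * p x"
  and csn_mult: "p (x * y) \<le> p x * p y"
  and csn_cstar: "p (fstar x * x) = (p x)\<^sup>2"
  and csn_isom: "p (fstar (gen i) * gen i - 1) = 0"
  and csn_sum: "p (gen I1 * fstar (gen I1) + gen I2 * fstar (gen I2) - 1) = 0"
  using p by (auto simp: cuntz_seminorm_def)

lemma csn_zero [simp]: "p 0 = 0"
  using csn_scale[of 0 0] by simp

lemma csn_uminus: "p (- x) = p x"
  using csn_scale[of "-1" x] by (simp add: fscale_minus_one)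

lemma csn_nonneg [simp]: "0 \<le> p x"
  using csn_add[of x "- x"] by (simp add: csn_uminus)

lemma csn_diff: "p (x - y) \<le> p x + p y"
  using csn_add[of x "- y"] by (simp add: csn_uminus)

lemma csn_diff_commute: "p (x - y) = p (y - x)"
  using csn_uminus[of "x - y"] by simp

lemma csn_diff3: "\<bar>p x - p y\<bar> \<le> p (x - y)"
  using csn_add[of "x - y" y] csn_add[of "y - x" x] csn_diff_commute[of x y] by simp

lemma csn_star: "p (fstar x) = p x"
proof -
  have le: "p y \<le> p (fstar y)" for y
  proof (cases "p y = 0")
    case False
    have "p y * p y \<le> p (fstar y) * p y"
      using csn_mult[of "fstar y" y] by (simp add: csn_cstar power2_eq_square)
    then show ?thesis using False csn_nonneg[of y] by (simp add: mult_le_cancel_right)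
  qed simp
  from le[of x] le[of "fstar x"] show ?thesis by simp
qed

lemma csn_one_le: "p 1 \<le> 1"
proof -
  have "(p 1)\<^sup>2 = p 1" using csn_cstar[of 1] by simp
  then show ?thesis by (auto simp: power2_eq_square)
qed

lemma csn_gen_le: "p (gen i) \<le> 1"
proof -
  have "(p (gen i))\<^sup>2 \<le> p (fstar (gen i) * gen i - 1) + p 1"
    using csn_add[of "fstar (gen i) * gen i - 1" 1] by (simp flip: csn_cstar)
  also have "\<dots> \<le> 1" by (simp add: csn_isom csn_one_le)
  finally show ?thesis by (simp add: power_le_one_iff abs_square_le_1)
qed

lemma csn_word_le: "p (Poly_Mapping.single w 1) \<le> 1"
proof -
  have "p (Poly_Mapping.single (Word u) 1) \<le> 1" for u
  proof (induction u)
    case Nil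
    then show ?case using csn_one_le by (simp flip: zero_word_def)
  next
    case (Cons l u)
    have "p (Poly_Mapping.single (Word [l]) 1) \<le> 1"
    proof (cases l)
      case (Gen i)
      then show ?thesis using csn_gen_le[of i] by (simp add: gen_def)
    next
      case (Adj i)
      then show ?thesis using csn_gen_le[of i] csn_star[of "gen i"] by (simp add: gen_def)
    qed
    moreover have "Poly_Mapping.single (Word (l # u)) 1 =
      Poly_Mapping.single (Word [l]) (1::complex) * Poly_Mapping.single (Word u) 1"
      by (simp add: mult_single)
    ultimately show ?case using Cons csn_mult csn_nonneg
      by (smt (verit) mult_le_one)
  qed
  then show ?thesis by (cases w) simp
qed

lemma csn_bound: "p f \<le> (\<Sum>w\<in>Poly_Mapping.keys f. cmod (Poly_Mapping.lookup f w))"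
proof -
  have "f = (\<Sum>w\<in>Poly_Mapping.keys f. Poly_Mapping.single w (Poly_Mapping.lookup f w))"
    by (rule poly_mapping_eqI) (simp add: lookup_sum lookup_single when_def in_keys_iff sum.If_cases
        if_distrib cong: if_cong)
  moreover have "p (\<Sum>w\<in>A. Poly_Mapping.single w (c w)) \<le> (\<Sum>w\<in>A. cmod (c w))" if "finite A" for A c
    using that
  proof (induction A rule: finite_induct)
    case (insert w A)
    have "p (Poly_Mapping.single w (c w)) \<le> cmod (c w)"
      using csn_scale[of "c w" "Poly_Mapping.single w 1"] csn_word_le[of w]
      by (simp add: fscale_single mult_left_le)
    then show ?case using insert csn_add[of "Poly_Mapping.single w (c w)" "\<Sum>w\<in>A. Poly_Mapping.single w (c w)"]
      by simp
  qed simp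
  ultimately show ?thesis by (metis finite_keys)
qed

end

text \<open>The relations have a nonzero model: the generators act on finitely supported sequences by
  \<open>e\<^sub>n \<mapsto> e\<^sub>2\<^sub>n\<close> and \<open>e\<^sub>n \<mapsto> e\<^sub>2\<^sub>n\<^sub>+\<^sub>1\<close>.
  This is only used to see that the universal C*-algebra is nonzero.\<close>

fun ix :: "index \<Rightarrow> nat" where
  "ix I1 = 0"
| "ix I2 = 1"

fun act_letter :: "letter \<Rightarrow> (nat \<Rightarrow> complex) \<Rightarrow> nat \<Rightarrow> complex" where
  "act_letter (Gen i) \<xi> = (\<lambda>n. if n mod 2 = ix i then \<xi> (n div 2) else 0)"
| "act_letter (Adj i) \<xi> = (\<lambda>n. \<xi> (2 * n + ix i))"

fun act_word :: "word \<Rightarrow> (nat \<Rightarrow> complex) \<Rightarrow> nat \<Rightarrow> complex" where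
  "act_word (Word u) \<xi> = foldr act_letter u \<xi>"

definition act :: "free_alg \<Rightarrow> (nat \<Rightarrow> complex) \<Rightarrow> nat \<Rightarrow> complex" where
  "act f \<xi> = (\<lambda>n. lin (*) (\<lambda>w. act_word w \<xi> n) f)"

lemma act_word_plus: "act_word (v + w) \<xi> = act_word v (act_word w \<xi>)"
  by (cases v; cases w) simp

lemma act_word_zero [simp]: "act_word 0 \<xi> = \<xi>"
  by (simp add: zero_word_def)

lemma act_letter_lin:
  "act_letter l (\<lambda>n. \<xi> n + \<eta> n) = (\<lambda>n. act_letter l \<xi> n + act_letter l \<eta> n)"
  "act_letter l (\<lambda>n. c * \<xi> n) = (\<lambda>n. c * act_letter l \<xi> n)"
  by (cases l; auto)+

lemma act_word_lin:
  "act_word w (\<lambda>n. \<xi> n + \<eta> n) = (\<lambda>n. act_word w \<xi> n + act_word w \<eta> n)"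
  "act_word w (\<lambda>n. c * \<xi> n) = (\<lambda>n. c * act_word w \<xi> n)"
proof -
  have "foldr act_letter u (\<lambda>n. \<xi> n + \<eta> n) = (\<lambda>n. foldr act_letter u \<xi> n + foldr act_letter u \<eta> n)" for u
    by (induction u) (simp_all add: act_letter_lin)
  then show "act_word w (\<lambda>n. \<xi> n + \<eta> n) = (\<lambda>n. act_word w \<xi> n + act_word w \<eta> n)"
    by (cases w) simp
  have "foldr act_letter u (\<lambda>n. c * \<xi> n) = (\<lambda>n. c * foldr act_letter u \<xi> n)" for u
    by (induction u) (simp_all add: act_letter_lin)
  then show "act_word w (\<lambda>n. c * \<xi> n) = (\<lambda>n. c * act_word w \<xi> n)"
    by (cases w) simp
qed

lemma act_word_null [simp]: "act_word w (\<lambda>n. 0) = (\<lambda>n. 0)"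
  using act_word_lin(2)[of w 0 "\<lambda>n. 0"] by simp

lemma act_zero [simp]: "act 0 \<xi> = (\<lambda>n. 0)"
  by (simp add: act_def)

lemma act_single: "act (Poly_Mapping.single w c) \<xi> = (\<lambda>n. c * act_word w \<xi> n)"
  by (simp add: act_def lin_single)

lemma act_add: "act (f + g) \<xi> = (\<lambda>n. act f \<xi> n + act g \<xi> n)"
  unfolding act_def by (subst lin_add) (simp_all add: distrib_right)

lemma act_diff: "act (f - g) \<xi> = (\<lambda>n. act f \<xi> n - act g \<xi> n)"
  using act_add[of "f - g" g \<xi>] by (simp add: fun_eq_iff)

lemma act_one [simp]: "act 1 \<xi> = \<xi>"
  using act_single[of 0 1 \<xi>] by simp

lemma act_mult: "act (f * g) \<xi> = act f (act g \<xi>)"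
proof (induction f rule: free_induct)
  case (single w c)
  show ?case
    by (induction g rule: free_induct)
      (simp_all add: mult_single act_single act_word_plus act_word_lin distrib_left act_add fun_eq_iff)
qed (simp_all add: distrib_right act_add)

lemma act_scale: "act (fscale c f) \<xi> = (\<lambda>n. c * act f \<xi> n)"
  by (simp add: fscale_def act_mult act_single)

definition supp_below :: "nat \<Rightarrow> (nat \<Rightarrow> complex) \<Rightarrow> bool" where
  "supp_below N \<xi> \<longleftrightarrow> (\<forall>n\<ge>N. \<xi> n = 0)"

definition fin_supp :: "(nat \<Rightarrow> complex) \<Rightarrow> bool" where
  "fin_supp \<xi> \<longleftrightarrow> (\<exists>N. supp_below N \<xi>)"

lemma supp_below_mono: "supp_below N \<xi> \<Longrightarrow> N \<le> M \<Longrightarrow> supp_below M \<xi>"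
  by (auto simp: supp_below_def)

lemma supp_below_letter: "supp_below N \<xi> \<Longrightarrow> supp_below (2 * N) (act_letter l \<xi>)"
  by (cases l) (auto simp: supp_below_def)

lemma fin_supp_letter: "fin_supp \<xi> \<Longrightarrow> fin_supp (act_letter l \<xi>)"
  using supp_below_letter by (auto simp: fin_supp_def)

lemma fin_supp_word: "fin_supp \<xi> \<Longrightarrow> fin_supp (act_word w \<xi>)"
proof -
  assume *: "fin_supp \<xi>"
  have "fin_supp (foldr act_letter u \<xi>)" for u
    by (induction u) (simp_all add: * fin_supp_letter del: act_letter.simps)
  then show ?thesis by (cases w) simp
qed

lemma fin_supp_pair:
  assumes "fin_supp \<xi>" "fin_supp \<eta>"
  obtains N where "supp_below N \<xi>" "supp_below N \<eta>"
  using assms unfolding fin_supp_def by (metis max.cobounded1 max.cobounded2 supp_below_mono)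

lemma fin_supp_add: "fin_supp \<xi> \<Longrightarrow> fin_supp \<eta> \<Longrightarrow> fin_supp (\<lambda>n. \<xi> n + \<eta> n)"
  by (erule (1) fin_supp_pair) (auto simp: fin_supp_def supp_below_def intro!: exI)

lemma fin_supp_scale: "fin_supp \<xi> \<Longrightarrow> fin_supp (\<lambda>n. c * \<xi> n)"
  by (auto simp: fin_supp_def supp_below_def)

lemma fin_supp_act: "fin_supp \<xi> \<Longrightarrow> fin_supp (act f \<xi>)"
  by (induction f rule: free_induct)
    (auto simp: act_single act_add fin_supp_add fin_supp_scale fin_supp_word,
      simp add: fin_supp_def supp_below_def)

definition ip :: "(nat \<Rightarrow> complex) \<Rightarrow> (nat \<Rightarrow> complex) \<Rightarrow> complex" where
  "ip \<xi> \<eta> = Sum_any (\<lambda>n. \<xi> n * cnj (\<eta> n))"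

definition hnorm :: "(nat \<Rightarrow> complex) \<Rightarrow> real" where
  "hnorm \<xi> = sqrt (Re (ip \<xi> \<xi>))"

lemma ip_eq:
  assumes "supp_below N \<xi> \<or> supp_below N \<eta>"
  shows "ip \<xi> \<eta> = (\<Sum>n<N. \<xi> n * cnj (\<eta> n))"
  unfolding ip_def
  by (rule Sum_any.expand_superset) (use assms in \<open>auto simp: supp_below_def not_le[symmetric]\<close>)

lemma hnorm_eq:
  assumes "supp_below N \<xi>"
  shows "hnorm \<xi> = L2_set (\<lambda>n. cmod (\<xi> n)) {..<N}"
proof -
  have "Re (ip \<xi> \<xi>) = (\<Sum>n<N. (cmod (\<xi> n))\<^sup>2)"
    by (simp add: ip_eq[of N] assms complex_mult_cnj cmod_power2)
  then show ?thesis by (simp add: hnorm_def L2_set_def)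
qed

lemma hnorm_nonneg: "fin_supp \<xi> \<Longrightarrow> 0 \<le> hnorm \<xi>"
  by (auto simp: fin_supp_def hnorm_eq L2_set_nonneg)

lemma hnorm_zero [simp]: "hnorm (\<lambda>n. 0) = 0"
  by (simp add: hnorm_def ip_def)

lemma hnorm_sq: "fin_supp \<xi> \<Longrightarrow> (hnorm \<xi>)\<^sup>2 = cmod (ip \<xi> \<xi>)"
proof -
  assume "fin_supp \<xi>"
  then obtain N where N: "supp_below N \<xi>" by (auto simp: fin_supp_def)
  define s where "s = (\<Sum>n<N. (cmod (\<xi> n))\<^sup>2)"
  have "ip \<xi> \<xi> = complex_of_real s"
    by (simp add: s_def ip_eq[of N] N complex_norm_square[symmetric])
  moreover have "0 \<le> s" by (simp add: s_def sum_nonneg)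
  ultimately show ?thesis by (simp add: hnorm_def)
qed

lemma ip_commute:
  assumes "fin_supp \<xi>"
  shows "ip \<xi> \<eta> = cnj (ip \<eta> \<xi>)"
proof -
  obtain N where N: "supp_below N \<xi>" using assms by (auto simp: fin_supp_def)
  then show ?thesis using ip_eq[of N \<xi> \<eta>] ip_eq[of N \<eta> \<xi>] by (simp add: mult.commute)
qed

lemma cauchy_schwarz:
  assumes "fin_supp \<xi>" "fin_supp \<eta>"
  shows "cmod (ip \<xi> \<eta>) \<le> hnorm \<xi> * hnorm \<eta>"
proof -
  obtain N where N: "supp_below N \<xi>" "supp_below N \<eta>" using fin_supp_pair[OF assms] .
  have "cmod (ip \<xi> \<eta>) \<le> (\<Sum>n<N. \<bar>cmod (\<xi> n)\<bar> * \<bar>cmod (\<eta> n)\<bar>)"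
    unfolding ip_eq[OF disjI1, OF N(1)]
    by (rule order_trans[OF norm_sum]) (simp add: norm_mult)
  also have "\<dots> \<le> hnorm \<xi> * hnorm \<eta>"
    unfolding hnorm_eq[OF N(1)] hnorm_eq[OF N(2)] by (rule L2_set_mult_ineq)
  finally show ?thesis .
qed

lemma hnorm_add:
  assumes "fin_supp \<xi>" "fin_supp \<eta>"
  shows "hnorm (\<lambda>n. \<xi> n + \<eta> n) \<le> hnorm \<xi> + hnorm \<eta>"
proof -
  obtain N where N: "supp_below N \<xi>" "supp_below N \<eta>" using fin_supp_pair[OF assms] .
  have s: "supp_below N (\<lambda>n. \<xi> n + \<eta> n)" using N by (simp add: supp_below_def)
  have "hnorm (\<lambda>n. \<xi> n + \<eta> n) \<le> L2_set (\<lambda>n. cmod (\<xi> n) + cmod (\<eta> n)) {..<N}"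
    unfolding hnorm_eq[OF s] by (rule L2_set_mono) (auto intro: norm_triangle_ineq)
  also have "\<dots> \<le> hnorm \<xi> + hnorm \<eta>"
    unfolding hnorm_eq[OF N(1)] hnorm_eq[OF N(2)] by (rule L2_set_triangle_ineq)
  finally show ?thesis .
qed

lemma hnorm_scale:
  assumes "fin_supp \<xi>"
  shows "hnorm (\<lambda>n. c * \<xi> n) = cmod c * hnorm \<xi>"
proof -
  obtain N where N: "supp_below N \<xi>" using assms by (auto simp: fin_supp_def)
  have s: "supp_below N (\<lambda>n. c * \<xi> n)" using N by (simp add: supp_below_def)
  show ?thesis unfolding hnorm_eq[OF N] hnorm_eq[OF s] by (simp add: norm_mult L2_set_right_distrib)
qed

lemma ip_gen:
  assumes "fin_supp \<xi>"
  shows "ip (act_letter (Gen i) \<xi>) \<eta> = ip \<xi> (act_letter (Adj i) \<eta>)"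
proof -
  obtain N where N: "supp_below N \<xi>" using assms by (auto simp: fin_supp_def)
  have "(\<Sum>n<2*M. (if n mod 2 = ix i then \<xi> (n div 2) else 0) * cnj (\<eta> n))
      = (\<Sum>n<M. \<xi> n * cnj (\<eta> (2 * n + ix i)))" for M
    by (induction M) (cases i; simp)+
  then show ?thesis
    using ip_eq[OF disjI1, OF N] ip_eq[OF disjI1, OF supp_below_letter[OF N, of "Gen i"]] by simp
qed

lemma ip_letter:
  assumes "fin_supp \<xi>" "fin_supp \<eta>"
  shows "ip (act_letter l \<xi>) \<eta> = ip \<xi> (act_letter (adj_letter l) \<eta>)"
proof (cases l)
  case (Adj i)
  then show ?thesis
    using assms ip_gen[of \<eta> i \<xi>] ip_commute fin_supp_letter
    by (metis adj_letter.simps(2))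
qed (simp add: ip_gen assms del: act_letter.simps)

lemma ip_word:
  assumes "fin_supp \<xi>" "fin_supp \<eta>"
  shows "ip (act_word w \<xi>) \<eta> = ip \<xi> (act_word (adj_word w) \<eta>)"
proof -
  have "ip (act_word (Word u) \<xi>) \<eta> = ip \<xi> (act_word (adj_word (Word u)) \<eta>)" for u
    using assms(2)
  proof (induction u arbitrary: \<eta>)
    case (Cons l u)
    have "ip (act_word (Word (l # u)) \<xi>) \<eta> = ip (act_word (Word u) \<xi>) (act_letter (adj_letter l) \<eta>)"
      using ip_letter[of "act_word (Word u) \<xi>" \<eta> l] fin_supp_word[OF assms(1), of "Word u"] Cons.prems
      by (simp del: act_letter.simps)
    then show ?case using Cons.IH[of "act_letter (adj_letter l) \<eta>"] fin_supp_letter[OF Cons.prems]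
      by (simp del: act_letter.simps)
  qed simp
  then show ?thesis by (cases w) metis
qed

lemma ip_add_left:
  "fin_supp \<xi> \<Longrightarrow> fin_supp \<eta> \<Longrightarrow> ip (\<lambda>n. \<xi> n + \<eta> n) \<zeta> = ip \<xi> \<zeta> + ip \<eta> \<zeta>"
proof (erule (1) fin_supp_pair)
  fix N assume N: "supp_below N \<xi>" "supp_below N \<eta>"
  then have s: "supp_below N (\<lambda>n. \<xi> n + \<eta> n)" by (simp add: supp_below_def)
  show ?thesis
    unfolding ip_eq[OF disjI1, OF N(1)] ip_eq[OF disjI1, OF N(2)] ip_eq[OF disjI1, OF s]
    by (simp add: distrib_right sum.distrib)
qed

lemma ip_add_right:
  "fin_supp \<xi> \<Longrightarrow> ip \<xi> (\<lambda>n. \<eta> n + \<zeta> n) = ip \<xi> \<eta> + ip \<xi> \<zeta>"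
  by (auto simp: fin_supp_def ip_eq[OF disjI1] distrib_left sum.distrib)

lemma ip_scale: "fin_supp \<xi> \<Longrightarrow> ip (\<lambda>n. c * \<xi> n) \<eta> = ip \<xi> (\<lambda>n. cnj c * \<eta> n)"
proof -
  assume "fin_supp \<xi>"
  then obtain N where N: "supp_below N \<xi>" by (auto simp: fin_supp_def)
  then have s: "supp_below N (\<lambda>n. c * \<xi> n)" by (simp add: supp_below_def)
  show ?thesis unfolding ip_eq[OF disjI1, OF N] ip_eq[OF disjI1, OF s] by (simp add: mult_ac)
qed

lemma ip_act:
  assumes "fin_supp \<xi>" "fin_supp \<eta>"
  shows "ip (act f \<xi>) \<eta> = ip \<xi> (act (fstar f) \<eta>)"
proof (induction f rule: free_induct)
  case zero
  then show ?case by (simp add: ip_def)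
next
  case (single w c)
  have "ip (\<lambda>n. c * act_word w \<xi> n) \<eta> = ip (act_word w \<xi>) (\<lambda>n. cnj c * \<eta> n)"
    by (rule ip_scale) (simp add: fin_supp_word assms)
  also have "\<dots> = ip \<xi> (\<lambda>n. cnj c * act_word (adj_word w) \<eta> n)"
    using ip_word[OF assms(1) fin_supp_scale[OF assms(2)]] by (simp add: act_word_lin)
  finally show ?case by (simp add: act_single)
next
  case (add f g)
  then show ?case by (simp add: act_add fstar_add ip_add_left ip_add_right fin_supp_act assms)
qed

lemma hnorm_letter:
  assumes "fin_supp \<xi>"
  shows "hnorm (act_letter l \<xi>) \<le> hnorm \<xi>"
proof (cases l)
  case (Gen i)
  have "act_letter (Adj i) (act_letter (Gen i) \<xi>) = \<xi>" by (cases i) (auto simp: fun_eq_iff)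
  then show ?thesis
    using ip_gen[OF assms, of i "act_letter (Gen i) \<xi>"] by (simp add: hnorm_def Gen del: act_letter.simps)
next
  case (Adj i)
  let ?\<eta> = "act_letter (Adj i) \<xi>"
  have "act_letter (Adj i) (act_letter (Gen i) ?\<eta>) = ?\<eta>" by (cases i) (auto simp: fun_eq_iff)
  moreover have f: "fin_supp ?\<eta>" by (rule fin_supp_letter[OF assms])
  ultimately have g: "hnorm (act_letter (Gen i) ?\<eta>) = hnorm ?\<eta>"
    using ip_gen[of ?\<eta> i "act_letter (Gen i) ?\<eta>"] by (simp add: hnorm_def del: act_letter.simps)
  have "(hnorm ?\<eta>)\<^sup>2 = cmod (ip \<xi> (act_letter (Gen i) ?\<eta>))"
    using hnorm_sq[OF f] ip_letter[OF assms f, of "Adj i"] by (simp del: act_letter.simps)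
  also have "\<dots> \<le> hnorm \<xi> * hnorm ?\<eta>"
    using cauchy_schwarz[OF assms fin_supp_letter[OF f, of "Gen i"]] g by simp
  finally have "hnorm ?\<eta> * hnorm ?\<eta> \<le> hnorm \<xi> * hnorm ?\<eta>" by (simp add: power2_eq_square)
  then show ?thesis using hnorm_nonneg[OF f] hnorm_nonneg[OF assms] Adj
    by (cases "hnorm ?\<eta> = 0") (auto simp: mult_le_cancel_right simp del: act_letter.simps)
qed

lemma hnorm_word: "fin_supp \<xi> \<Longrightarrow> hnorm (act_word w \<xi>) \<le> hnorm \<xi>"
proof -
  assume s: "fin_supp \<xi>"
  have "hnorm (act_word (Word u) \<xi>) \<le> hnorm \<xi>" for u
  proof (induction u)
    case (Cons l u)
    show ?case using hnorm_letter[OF fin_supp_word[OF s, of "Word u"], of l] Cons by simp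
  qed simp
  then show ?thesis by (cases w) metis
qed

definition act_bounds :: "free_alg \<Rightarrow> real set" where
  "act_bounds f = {C. 0 \<le> C \<and> (\<forall>\<xi>. fin_supp \<xi> \<longrightarrow> hnorm (act f \<xi>) \<le> C * hnorm \<xi>)}"

definition act_norm :: "free_alg \<Rightarrow> real" where
  "act_norm f = Inf (act_bounds f)"

lemma act_bounds_nonempty: "\<exists>C. C \<in> act_bounds f"
proof (induction f rule: free_induct)
  case zero
  then show ?case by (intro exI[of _ 0]) (simp add: act_bounds_def)
next
  case (single w c)
  then show ?case
    by (intro exI[of _ "cmod c"])
      (auto simp: act_bounds_def act_single hnorm_scale fin_supp_word intro!: mult_left_mono hnorm_word)
next
  case (add f g)
  then obtain C D where "C \<in> act_bounds f" "D \<in> act_bounds g" by blast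
  then have "C + D \<in> act_bounds (f + g)"
    by (auto simp: act_bounds_def act_add distrib_right
        intro!: order_trans[OF hnorm_add] fin_supp_act add_mono)
  then show ?case by blast
qed

lemma act_norm_nonneg: "0 \<le> act_norm f"
  unfolding act_norm_def by (rule cInf_greatest) (use act_bounds_nonempty in \<open>auto simp: act_bounds_def\<close>)

lemma act_norm_le: "C \<in> act_bounds f \<Longrightarrow> act_norm f \<le> C"
  unfolding act_norm_def by (rule cInf_lower) (auto simp: act_bounds_def bdd_below_def)

lemma act_norm_bound:
  assumes "fin_supp \<xi>"
  shows "hnorm (act f \<xi>) \<le> act_norm f * hnorm \<xi>"
proof (cases "hnorm \<xi> = 0")
  case True
  then show ?thesis using act_bounds_nonempty[of f] assms by (auto simp: act_bounds_def)
next
  case False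
  then have h: "0 < hnorm \<xi>" using hnorm_nonneg[OF assms] by simp
  have "hnorm (act f \<xi>) / hnorm \<xi> \<le> act_norm f"
    unfolding act_norm_def
    by (rule cInf_greatest) (use act_bounds_nonempty assms h in \<open>auto simp: act_bounds_def divide_le_eq\<close>)
  then show ?thesis using h by (simp add: divide_le_eq)
qed

lemma act_norm_mult: "act_norm (f * g) \<le> act_norm f * act_norm g"
proof (rule act_norm_le)
  have "hnorm (act f (act g \<xi>)) \<le> act_norm f * act_norm g * hnorm \<xi>" if "fin_supp \<xi>" for \<xi>
    using act_norm_bound[OF fin_supp_act[OF that], of f g]
      mult_left_mono[OF act_norm_bound[OF that, of g] act_norm_nonneg[of f]] by simp
  then show "act_norm f * act_norm g \<in> act_bounds (f * g)"
    by (simp add: act_bounds_def act_norm_nonneg act_mult)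
qed

lemma act_norm_sq_le: "(act_norm f)\<^sup>2 \<le> act_norm (fstar f * f)"
proof -
  have "act_norm f \<le> sqrt (act_norm (fstar f * f))"
  proof (rule act_norm_le)
    have "hnorm (act f \<xi>) \<le> sqrt (act_norm (fstar f * f)) * hnorm \<xi>" if s: "fin_supp \<xi>" for \<xi>
    proof (rule power2_le_imp_le)
      have "(hnorm (act f \<xi>))\<^sup>2 = cmod (ip \<xi> (act (fstar f * f) \<xi>))"
        by (simp add: hnorm_sq ip_act fin_supp_act s act_mult)
      also have "\<dots> \<le> hnorm \<xi> * (act_norm (fstar f * f) * hnorm \<xi>)"
        by (rule order_trans[OF cauchy_schwarz])
          (auto intro!: mult_left_mono act_norm_bound simp: s fin_supp_act hnorm_nonneg)
      also have "\<dots> = (sqrt (act_norm (fstar f * f)) * hnorm \<xi>)\<^sup>2"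
        by (simp add: power_mult_distrib act_norm_nonneg power2_eq_square[of "hnorm \<xi>"])
      finally show "(hnorm (act f \<xi>))\<^sup>2 \<le> (sqrt (act_norm (fstar f * f)) * hnorm \<xi>)\<^sup>2" .
    qed (simp add: act_norm_nonneg hnorm_nonneg s)
    then show "sqrt (act_norm (fstar f * f)) \<in> act_bounds f"
      by (simp add: act_bounds_def act_norm_nonneg)
  qed
  then show ?thesis
    by (metis act_norm_nonneg power_mono real_sqrt_pow2)
qed

lemma act_norm_star_le: "act_norm (fstar f) \<le> act_norm f"
proof -
  have "act_norm (fstar f) * act_norm (fstar f) \<le> act_norm f * act_norm (fstar f)"
    using act_norm_sq_le[of "fstar f"] act_norm_mult[of f "fstar f"] by (simp add: power2_eq_square)
  then show ?thesis
    using act_norm_nonneg[of f] act_norm_nonneg[of "fstar f"]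
    by (cases "act_norm (fstar f) = 0") (auto simp: mult_le_cancel_right)
qed

lemma cuntz_seminorm_act_norm: "cuntz_seminorm act_norm"
  unfolding cuntz_seminorm_def
proof (intro conjI allI)
  fix f g c i
  show "act_norm (f + g) \<le> act_norm f + act_norm g"
  proof (rule act_norm_le)
    show "act_norm f + act_norm g \<in> act_bounds (f + g)"
      by (auto simp: act_bounds_def act_add distrib_right act_norm_nonneg
          intro!: order_trans[OF hnorm_add] fin_supp_act add_mono act_norm_bound)
  qed
  show "act_norm (f * g) \<le> act_norm f * act_norm g" by (rule act_norm_mult)
  have sc: "act_norm (fscale c f) \<le> cmod c * act_norm f" for c f
  proof (rule act_norm_le)
    show "cmod c * act_norm f \<in> act_bounds (fscale c f)"
      by (auto simp: act_bounds_def act_scale act_norm_nonneg hnorm_scale fin_supp_act mult.assoc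
          intro!: mult_left_mono act_norm_bound)
  qed
  show "act_norm (fscale c f) = cmod c * act_norm f"
  proof (cases "c = 0")
    case True
    then show ?thesis using sc[of c f] act_norm_nonneg[of "fscale c f"] by simp
  next
    case False
    have "act_norm f \<le> cmod (inverse c) * act_norm (fscale c f)"
      using sc[of "inverse c" "fscale c f"] False by (simp add: fscale_fscale)
    then show ?thesis using sc[of c f] False by (simp add: norm_divide field_simps)
  qed
  have "act_norm (fstar f) * act_norm f \<le> act_norm f * act_norm f"
    by (rule mult_right_mono[OF act_norm_star_le act_norm_nonneg])
  then show "act_norm (fstar f * f) = (act_norm f)\<^sup>2"
    using act_norm_sq_le[of f] act_norm_mult[of "fstar f" f] by (simp add: power2_eq_square)
  have z: "act_norm h = 0" if "\<And>\<xi>. act h \<xi> = (\<lambda>n. 0)" for h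
  proof -
    have "0 \<in> act_bounds h" by (simp add: act_bounds_def that)
    then show ?thesis using act_norm_le act_norm_nonneg by (metis antisym)
  qed
  show "act_norm (fstar (gen i) * gen i - 1) = 0"
    by (rule z, cases i) (auto simp: act_diff act_mult gen_def act_single fun_eq_iff)
  show "act_norm (gen I1 * fstar (gen I1) + gen I2 * fstar (gen I2) - 1) = 0"
  proof (rule z)
    fix \<xi>
    have "act (gen I1 * fstar (gen I1) + gen I2 * fstar (gen I2) - 1) \<xi> n = 0" for n
    proof (cases "even n")
      case True
      then show ?thesis by (auto simp: act_diff act_add act_mult gen_def act_single elim!: evenE)
    next
      case False
      then show ?thesis by (auto simp: act_diff act_add act_mult gen_def act_single elim!: oddE)
    qed
    then show "act (gen I1 * fstar (gen I1) + gen I2 * fstar (gen I2) - 1) \<xi> = (\<lambda>n. 0)"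
      by (simp add: fun_eq_iff)
  qed
qed

lemma act_norm_one: "act_norm 1 \<ge> 1"
proof -
  let ?\<delta> = "\<lambda>n::nat. if n = 0 then 1 else (0::complex)"
  have s: "supp_below 1 ?\<delta>" by (simp add: supp_below_def)
  then have "hnorm ?\<delta> = 1" by (simp add: hnorm_eq L2_set_def)
  moreover have "fin_supp ?\<delta>" using s by (auto simp: fin_supp_def)
  ultimately show ?thesis using act_norm_bound[of ?\<delta> 1] by simp
qed

lemma cuntz_norm_upper: "cuntz_seminorm p \<Longrightarrow> p x \<le> cuntz_norm x"
  unfolding cuntz_norm_def
  by (rule cSUP_upper) (auto intro!: bdd_aboveI2 csn_bound)

lemma cuntz_norm_least: "(\<And>p. cuntz_seminorm p \<Longrightarrow> p x \<le> C) \<Longrightarrow> cuntz_norm x \<le> C"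
  unfolding cuntz_norm_def
  by (rule cSUP_least) (use cuntz_seminorm_act_norm in auto)

lemma cuntz_norm_nonneg: "0 \<le> cuntz_norm x"
  using cuntz_norm_upper[OF cuntz_seminorm_act_norm] act_norm_nonneg order_trans by blast

lemma cuntz_seminorm_cuntz_norm: "cuntz_seminorm cuntz_norm"
  unfolding cuntz_seminorm_def
proof (intro conjI allI)
  fix x y c i
  show "cuntz_norm (x + y) \<le> cuntz_norm x + cuntz_norm y"
    by (rule cuntz_norm_least, rule order_trans[OF csn_add]) (auto intro: add_mono cuntz_norm_upper)
  show "cuntz_norm (x * y) \<le> cuntz_norm x * cuntz_norm y"
    by (rule cuntz_norm_least, rule order_trans[OF csn_mult])
      (auto intro!: mult_mono cuntz_norm_upper cuntz_norm_nonneg csn_nonneg)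
  have sc: "cuntz_norm (fscale c x) \<le> cmod c * cuntz_norm x" for c x
    by (rule cuntz_norm_least) (auto simp: csn_scale intro!: mult_left_mono cuntz_norm_upper)
  show "cuntz_norm (fscale c x) = cmod c * cuntz_norm x"
  proof (cases "c = 0")
    case True
    then show ?thesis using sc[of c x] cuntz_norm_nonneg[of "fscale c x"] by simp
  next
    case False
    have "cuntz_norm x \<le> cmod (inverse c) * cuntz_norm (fscale c x)"
      using sc[of "inverse c" "fscale c x"] False by (simp add: fscale_fscale)
    then show ?thesis using sc[of c x] False by (simp add: norm_divide field_simps)
  qed
  have "cuntz_norm (fstar x * x) \<le> (cuntz_norm x)\<^sup>2"
    by (rule cuntz_norm_least) (auto simp: csn_cstar csn_nonneg intro!: power_mono cuntz_norm_upper)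
  moreover have "cuntz_norm x \<le> sqrt (cuntz_norm (fstar x * x))"
  proof (rule cuntz_norm_least)
    fix p assume "cuntz_seminorm p"
    then show "p x \<le> sqrt (cuntz_norm (fstar x * x))"
      using cuntz_norm_upper[of p "fstar x * x"] by (intro real_le_rsqrt) (simp add: csn_cstar)
  qed
  then have "(cuntz_norm x)\<^sup>2 \<le> cuntz_norm (fstar x * x)"
    by (metis cuntz_norm_nonneg power_mono real_sqrt_pow2)
  ultimately show "cuntz_norm (fstar x * x) = (cuntz_norm x)\<^sup>2" by simp
  show "cuntz_norm (fstar (gen i) * gen i - 1) = 0"
    by (rule antisym[OF cuntz_norm_least cuntz_norm_nonneg]) (simp add: csn_isom)
  show "cuntz_norm (gen I1 * fstar (gen I1) + gen I2 * fstar (gen I2) - 1) = 0"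
    by (rule antisym[OF cuntz_norm_least cuntz_norm_nonneg]) (simp add: csn_sum)
qed

lemma cuntz_norm_one: "cuntz_norm 1 = 1"
  using csn_one_le[OF cuntz_seminorm_cuntz_norm] act_norm_one
    cuntz_norm_upper[OF cuntz_seminorm_act_norm, of 1] by simp

subsection \<open>The completion\<close>

definition cuntz_Cauchy :: "(nat \<Rightarrow> free_alg) \<Rightarrow> bool" where
  "cuntz_Cauchy X \<longleftrightarrow> (\<forall>e>0. \<exists>M. \<forall>m\<ge>M. \<forall>n\<ge>M. cuntz_norm (X m - X n) < e)"

definition cuntz_rel :: "(nat \<Rightarrow> free_alg) \<Rightarrow> (nat \<Rightarrow> free_alg) \<Rightarrow> bool" where
  "cuntz_rel X Y \<longleftrightarrow> cuntz_Cauchy X \<and> cuntz_Cauchy Y \<and> (\<lambda>n. cuntz_norm (X n - Y n)) \<longlonglongrightarrow> 0"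

lemmas cn = cuntz_seminorm_cuntz_norm

lemmas cn_simps [simp] = csn_zero[OF cn] csn_scale[OF cn] csn_cstar[OF cn] csn_isom[OF cn]
  csn_sum[OF cn] csn_uminus[OF cn] csn_nonneg[OF cn] csn_star[OF cn] cuntz_norm_one

lemma cuntz_Cauchy_const [simp]: "cuntz_Cauchy (\<lambda>n. c)"
  by (simp add: cuntz_Cauchy_def)

lemma cuntz_rel_refl [simp]: "cuntz_rel X X \<longleftrightarrow> cuntz_Cauchy X"
  by (simp add: cuntz_rel_def)

lemma cuntz_Cauchy_dom:
  assumes "cuntz_Cauchy X" "cuntz_Cauchy Y" "0 < K"
    and le: "\<And>m n. cuntz_norm (Z m - Z n) \<le> K * (cuntz_norm (X m - X n) + cuntz_norm (Y m - Y n))"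
  shows "cuntz_Cauchy Z"
  unfolding cuntz_Cauchy_def
proof (intro allI impI)
  fix e :: real assume e: "0 < e"
  then have e': "0 < e / (2 * K)" using assms(3) by simp
  obtain M where M: "\<And>m n. m \<ge> M \<Longrightarrow> n \<ge> M \<Longrightarrow> cuntz_norm (X m - X n) < e / (2 * K)"
    using assms(1) e' unfolding cuntz_Cauchy_def by blast
  obtain L where L: "\<And>m n. m \<ge> L \<Longrightarrow> n \<ge> L \<Longrightarrow> cuntz_norm (Y m - Y n) < e / (2 * K)"
    using assms(2) e' unfolding cuntz_Cauchy_def by blast
  have "cuntz_norm (Z m - Z n) < e" if "m \<ge> max M L" "n \<ge> max M L" for m n
  proof -
    have "cuntz_norm (X m - X n) + cuntz_norm (Y m - Y n) < e / K"
      using M[of m n] L[of m n] that by simp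
    then have "K * (cuntz_norm (X m - X n) + cuntz_norm (Y m - Y n)) < e"
      using assms(3) by (simp add: field_simps)
    then show ?thesis using le[of m n] by linarith
  qed
  then show "\<exists>M. \<forall>m\<ge>M. \<forall>n\<ge>M. cuntz_norm (Z m - Z n) < e" by blast
qed

lemma cuntz_Cauchy_norm:
  assumes "cuntz_Cauchy X"
  shows "convergent (\<lambda>n. cuntz_norm (X n))"
proof (rule real_Cauchy_convergent, rule CauchyI)
  fix e :: real assume "0 < e"
  then obtain M where M: "\<And>m n. m \<ge> M \<Longrightarrow> n \<ge> M \<Longrightarrow> cuntz_norm (X m - X n) < e"
    using assms unfolding cuntz_Cauchy_def by blast
  have "norm (cuntz_norm (X m) - cuntz_norm (X n)) < e" if "m \<ge> M" "n \<ge> M" for m n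
    using M[OF that] csn_diff3[OF cn, of "X m" "X n"] by simp
  then show "\<exists>M. \<forall>m\<ge>M. \<forall>n\<ge>M. norm (cuntz_norm (X m) - cuntz_norm (X n)) < e" by blast
qed

lemma cuntz_Cauchy_bounded:
  assumes "cuntz_Cauchy X"
  shows "\<exists>B>0. \<forall>n. cuntz_norm (X n) \<le> B"
proof -
  have "Bseq (\<lambda>n. cuntz_norm (X n))"
    using cuntz_Cauchy_norm[OF assms] by (rule convergent_imp_Bseq)
  then show ?thesis by (auto simp: Bseq_def)
qed

lemma cuntz_Cauchy_add:
  assumes "cuntz_Cauchy X" "cuntz_Cauchy Y"
  shows "cuntz_Cauchy (\<lambda>n. X n + Y n)"
proof (rule cuntz_Cauchy_dom[OF assms, of 1])
  fix m n show "cuntz_norm (X m + Y m - (X n + Y n)) \<le> 1 * (cuntz_norm (X m - X n) + cuntz_norm (Y m - Y n))"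
    using csn_add[OF cn, of "X m - X n" "Y m - Y n"] by (simp add: algebra_simps)
qed simp

lemma cuntz_Cauchy_uminus:
  assumes "cuntz_Cauchy X"
  shows "cuntz_Cauchy (\<lambda>n. - X n)"
proof (rule cuntz_Cauchy_dom[OF assms assms, of 1])
  fix m n show "cuntz_norm (- X m - - X n) \<le> 1 * (cuntz_norm (X m - X n) + cuntz_norm (X m - X n))"
    using csn_diff_commute[OF cn, of "X m" "X n"] by simp
qed simp

lemma cuntz_Cauchy_diff:
  "cuntz_Cauchy X \<Longrightarrow> cuntz_Cauchy Y \<Longrightarrow> cuntz_Cauchy (\<lambda>n. X n - Y n)"
  using cuntz_Cauchy_add[OF _ cuntz_Cauchy_uminus, of X Y] by simp

lemma cuntz_Cauchy_scale:
  assumes "cuntz_Cauchy X"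
  shows "cuntz_Cauchy (\<lambda>n. fscale c (X n))"
proof (rule cuntz_Cauchy_dom[OF assms assms, of "cmod c + 1"])
  fix m n
  show "cuntz_norm (fscale c (X m) - fscale c (X n)) \<le> (cmod c + 1) * (cuntz_norm (X m - X n) + cuntz_norm (X m - X n))"
    by (simp flip: fscale_diff_right add: mult_mono)
qed (simp add: add_nonneg_pos)

lemma cuntz_Cauchy_star:
  assumes "cuntz_Cauchy X"
  shows "cuntz_Cauchy (\<lambda>n. fstar (X n))"
  by (rule cuntz_Cauchy_dom[OF assms assms, of 1]) (simp_all flip: fstar_diff)

lemma cuntz_norm_mult_diff:
  "cuntz_norm (x * y - x' * y') \<le> cuntz_norm (x - x') * cuntz_norm y + cuntz_norm x' * cuntz_norm (y - y')"
proof -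
  have "x * y - x' * y' = (x - x') * y + x' * (y - y')" by (simp add: algebra_simps)
  then show ?thesis
    using csn_add[OF cn, of "(x - x') * y" "x' * (y - y')"] csn_mult[OF cn, of "x - x'" y]
      csn_mult[OF cn, of x' "y - y'"] by simp
qed

lemma cuntz_Cauchy_mult:
  assumes "cuntz_Cauchy X" "cuntz_Cauchy Y"
  shows "cuntz_Cauchy (\<lambda>n. X n * Y n)"
proof -
  obtain B where B: "0 < B" "\<And>n. cuntz_norm (X n) \<le> B"
    using cuntz_Cauchy_bounded[OF assms(1)] by blast
  obtain C where C: "0 < C" "\<And>n. cuntz_norm (Y n) \<le> C"
    using cuntz_Cauchy_bounded[OF assms(2)] by blast
  show ?thesis
  proof (rule cuntz_Cauchy_dom[OF assms, of "B + C"])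
    fix m n
    have "cuntz_norm (X m * Y m - X n * Y n)
        \<le> cuntz_norm (X m - X n) * cuntz_norm (Y m) + cuntz_norm (X n) * cuntz_norm (Y m - Y n)"
      by (rule cuntz_norm_mult_diff)
    also have "\<dots> \<le> cuntz_norm (X m - X n) * (B + C) + (B + C) * cuntz_norm (Y m - Y n)"
      using B C by (intro add_mono mult_mono) (auto intro: order_trans[OF B(2)] order_trans[OF C(2)])
    finally show "cuntz_norm (X m * Y m - X n * Y n)
        \<le> (B + C) * (cuntz_norm (X m - X n) + cuntz_norm (Y m - Y n))"
      by (simp add: algebra_simps)
  qed (use B C in simp)
qed

lemmas cuntz_Cauchy_intros [simp] =
  cuntz_Cauchy_add cuntz_Cauchy_uminus cuntz_Cauchy_diff cuntz_Cauchy_scale cuntz_Cauchy_star cuntz_Cauchy_mult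

lemma null_dom:
  assumes "a \<longlonglongrightarrow> 0" "\<And>n. cuntz_norm (Z n) \<le> a n"
  shows "(\<lambda>n. cuntz_norm (Z n)) \<longlonglongrightarrow> 0"
  by (rule tendsto_sandwich[OF _ _ tendsto_const assms(1)]) (simp_all add: assms(2))

lemma cuntz_rel_add:
  assumes "cuntz_rel X X'" "cuntz_rel Y Y'"
  shows "cuntz_rel (\<lambda>n. X n + Y n) (\<lambda>n. X' n + Y' n)"
proof -
  have "(\<lambda>n. cuntz_norm (X n + Y n - (X' n + Y' n))) \<longlonglongrightarrow> 0"
  proof (rule null_dom)
    show "(\<lambda>n. cuntz_norm (X n - X' n) + cuntz_norm (Y n - Y' n)) \<longlonglongrightarrow> 0"
      using assms tendsto_add[of "\<lambda>n. cuntz_norm (X n - X' n)" 0] by (force simp: cuntz_rel_def)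
    show "cuntz_norm (X n + Y n - (X' n + Y' n)) \<le> cuntz_norm (X n - X' n) + cuntz_norm (Y n - Y' n)" for n
      using csn_add[OF cn, of "X n - X' n" "Y n - Y' n"] by (simp add: algebra_simps)
  qed
  with assms show ?thesis by (simp add: cuntz_rel_def)
qed

lemma cuntz_rel_uminus: "cuntz_rel X X' \<Longrightarrow> cuntz_rel (\<lambda>n. - X n) (\<lambda>n. - X' n)"
  by (simp add: cuntz_rel_def csn_diff_commute[OF cn])

lemma cuntz_rel_diff:
  "cuntz_rel X X' \<Longrightarrow> cuntz_rel Y Y' \<Longrightarrow> cuntz_rel (\<lambda>n. X n - Y n) (\<lambda>n. X' n - Y' n)"
  using cuntz_rel_add[OF _ cuntz_rel_uminus, of X X' Y Y'] by simp

lemma cuntz_rel_scale: "cuntz_rel X X' \<Longrightarrow> cuntz_rel (\<lambda>n. fscale c (X n)) (\<lambda>n. fscale c (X' n))"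
  using tendsto_mult_left[of "\<lambda>n. cuntz_norm (X n - X' n)" 0 sequentially "cmod c"]
  by (simp add: cuntz_rel_def flip: fscale_diff_right)

lemma cuntz_rel_star: "cuntz_rel X X' \<Longrightarrow> cuntz_rel (\<lambda>n. fstar (X n)) (\<lambda>n. fstar (X' n))"
  by (simp add: cuntz_rel_def flip: fstar_diff)

lemma cuntz_rel_mult:
  assumes "cuntz_rel X X'" "cuntz_rel Y Y'"
  shows "cuntz_rel (\<lambda>n. X n * Y n) (\<lambda>n. X' n * Y' n)"
proof -
  obtain b where b: "(\<lambda>n. cuntz_norm (X' n)) \<longlonglongrightarrow> b"
    using assms(1) cuntz_Cauchy_norm by (auto simp: cuntz_rel_def convergent_def)
  obtain c where c: "(\<lambda>n. cuntz_norm (Y n)) \<longlonglongrightarrow> c"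
    using assms(2) cuntz_Cauchy_norm by (auto simp: cuntz_rel_def convergent_def)
  have X: "(\<lambda>n. cuntz_norm (X n - X' n)) \<longlonglongrightarrow> 0" and Y: "(\<lambda>n. cuntz_norm (Y n - Y' n)) \<longlonglongrightarrow> 0"
    using assms by (auto simp: cuntz_rel_def)
  have "(\<lambda>n. cuntz_norm (X n * Y n - X' n * Y' n)) \<longlonglongrightarrow> 0"
  proof (rule null_dom)
    show "(\<lambda>n. cuntz_norm (X n - X' n) * cuntz_norm (Y n) + cuntz_norm (X' n) * cuntz_norm (Y n - Y' n)) \<longlonglongrightarrow> 0"
      using tendsto_add[OF tendsto_mult[OF X c] tendsto_mult[OF b Y]] by simp
  qed (rule cuntz_norm_mult_diff)
  with assms show ?thesis by (simp add: cuntz_rel_def)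
qed

lemma cuntz_rel_norm:
  assumes "cuntz_rel X Y" "(\<lambda>n. cuntz_norm (X n)) \<longlonglongrightarrow> l"
  shows "(\<lambda>n. cuntz_norm (Y n)) \<longlonglongrightarrow> l"
proof -
  have "(\<lambda>n. cuntz_norm (X n) - cuntz_norm (Y n)) \<longlonglongrightarrow> 0"
    by (rule Lim_null_comparison[of _ "\<lambda>n. cuntz_norm (X n - Y n)"])
      (use assms(1) csn_diff3[OF cn] in \<open>auto simp: cuntz_rel_def\<close>)
  from tendsto_diff[OF assms(2) this] show ?thesis by simp
qed

lemma part_equivp_cuntz_rel: "part_equivp cuntz_rel"
proof (rule part_equivpI)
  show "\<exists>X. cuntz_rel X X" by (rule exI[of _ "\<lambda>n. 0"]) simp
  show "symp cuntz_rel" by (rule sympI) (simp add: cuntz_rel_def csn_diff_commute[OF cn])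
  show "transp cuntz_rel"
  proof (rule transpI)
    fix X Y Z assume *: "cuntz_rel X Y" "cuntz_rel Y Z"
    have "(\<lambda>n. cuntz_norm (X n - Z n)) \<longlonglongrightarrow> 0"
    proof (rule null_dom)
      show "(\<lambda>n. cuntz_norm (X n - Y n) + cuntz_norm (Y n - Z n)) \<longlonglongrightarrow> 0"
        using * tendsto_add[of "\<lambda>n. cuntz_norm (X n - Y n)" 0] by (force simp: cuntz_rel_def)
      show "cuntz_norm (X n - Z n) \<le> cuntz_norm (X n - Y n) + cuntz_norm (Y n - Z n)" for n
        using csn_add[OF cn, of "X n - Y n" "Y n - Z n"] by simp
    qed
    with * show "cuntz_rel X Z" by (simp add: cuntz_rel_def)
  qed
qed

text \<open>The Cuntz algebra \<open>\<O>\<^sub>2\<close>: Hausdorff completion of the free *-algebra in the universal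
  C*-seminorm, as Cauchy sequences modulo null sequences. Its universal property is
  lemma \<open>cuntz2_universal\<close> below.\<close>

quotient_type cuntz2 = "nat \<Rightarrow> free_alg" / partial: cuntz_rel
  by (rule part_equivp_cuntz_rel)

lemma cuntz2_cases [cases type: cuntz2]:
  obtains X where "x = abs_cuntz2 X" "cuntz_Cauchy X"
  by (metis Quotient3_cuntz2 Quotient3_abs_rep Quotient3_rep_reflp cuntz_rel_refl)

lemma abs_cuntz2_eq: "cuntz_Cauchy X \<Longrightarrow> cuntz_Cauchy Y \<Longrightarrow> abs_cuntz2 X = abs_cuntz2 Y \<longleftrightarrow> cuntz_rel X Y"
  using Quotient3_rel[OF Quotient3_cuntz2, of X Y] by auto

instantiation cuntz2 :: ring_1
begin

lift_definition zero_cuntz2 :: cuntz2 is "\<lambda>n. 0" by simp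
lift_definition one_cuntz2 :: cuntz2 is "\<lambda>n. 1" by simp
lift_definition plus_cuntz2 :: "cuntz2 \<Rightarrow> cuntz2 \<Rightarrow> cuntz2" is "\<lambda>X Y n. X n + Y n" by (rule cuntz_rel_add)
lift_definition uminus_cuntz2 :: "cuntz2 \<Rightarrow> cuntz2" is "\<lambda>X n. - X n" by (rule cuntz_rel_uminus)
lift_definition minus_cuntz2 :: "cuntz2 \<Rightarrow> cuntz2 \<Rightarrow> cuntz2" is "\<lambda>X Y n. X n - Y n" by (rule cuntz_rel_diff)
lift_definition times_cuntz2 :: "cuntz2 \<Rightarrow> cuntz2 \<Rightarrow> cuntz2" is "\<lambda>X Y n. X n * Y n" by (rule cuntz_rel_mult)

lemmas cuntz2_ring_eqs = zero_cuntz2.abs_eq one_cuntz2.abs_eq plus_cuntz2.abs_eq uminus_cuntz2.abs_eq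
  minus_cuntz2.abs_eq times_cuntz2.abs_eq

instance
proof
  fix a b c :: cuntz2
  show "a + b + c = a + (b + c)" by (cases a; cases b; cases c) (simp add: cuntz2_ring_eqs add.assoc)
  show "a + b = b + a" by (cases a; cases b) (simp add: cuntz2_ring_eqs add.commute)
  show "0 + a = a" by (cases a) (simp add: cuntz2_ring_eqs)
  show "- a + a = 0" by (cases a) (simp add: cuntz2_ring_eqs)
  show "a - b = a + - b" by (cases a; cases b) (simp add: cuntz2_ring_eqs)
  show "a * b * c = a * (b * c)" by (cases a; cases b; cases c) (simp add: cuntz2_ring_eqs mult.assoc)
  show "1 * a = a" "a * 1 = a" by (cases a; simp add: cuntz2_ring_eqs)+
  show "(a + b) * c = a * c + b * c"
    by (cases a; cases b; cases c) (simp add: cuntz2_ring_eqs distrib_right)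
  show "a * (b + c) = a * b + a * c"
    by (cases a; cases b; cases c) (simp add: cuntz2_ring_eqs distrib_left)
  show "(0::cuntz2) \<noteq> 1"
    by (simp add: cuntz2_ring_eqs abs_cuntz2_eq) (simp add: cuntz_rel_def LIMSEQ_const_iff)
qed

end

instantiation cuntz2 :: "{scaleC, star}"
begin

lift_definition scaleC_cuntz2 :: "complex \<Rightarrow> cuntz2 \<Rightarrow> cuntz2" is "\<lambda>c X n. fscale c (X n)"
  by (rule cuntz_rel_scale)
lift_definition star_cuntz2 :: "cuntz2 \<Rightarrow> cuntz2" is "\<lambda>X n. fstar (X n)" by (rule cuntz_rel_star)

instance ..

end

lemmas cuntz2_eqs = cuntz2_ring_eqs scaleC_cuntz2.abs_eq star_cuntz2.abs_eq

instantiation cuntz2 :: real_vector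
begin

definition scaleR_cuntz2 :: "real \<Rightarrow> cuntz2 \<Rightarrow> cuntz2" where
  "scaleR_cuntz2 r x = complex_of_real r *\<^sub>C x"

instance
proof
  fix a b :: real and x y :: cuntz2
  show "a *\<^sub>R (x + y) = a *\<^sub>R x + a *\<^sub>R y"
    by (cases x; cases y) (simp add: scaleR_cuntz2_def cuntz2_eqs fscale_add_right)
  show "(a + b) *\<^sub>R x = a *\<^sub>R x + b *\<^sub>R x"
    by (cases x) (simp add: scaleR_cuntz2_def cuntz2_eqs fscale_add_left)
  show "a *\<^sub>R b *\<^sub>R x = (a * b) *\<^sub>R x"
    by (cases x) (simp add: scaleR_cuntz2_def cuntz2_eqs fscale_fscale)
  show "1 *\<^sub>R x = x"
    by (cases x) (simp add: scaleR_cuntz2_def cuntz2_eqs)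
qed

end

instantiation cuntz2 :: real_normed_algebra_1
begin

lift_definition norm_cuntz2 :: "cuntz2 \<Rightarrow> real" is "\<lambda>X. lim (\<lambda>n. cuntz_norm (X n))"
  by (metis convergentD cuntz_Cauchy_norm cuntz_rel_def cuntz_rel_norm limI)

definition dist_cuntz2 :: "cuntz2 \<Rightarrow> cuntz2 \<Rightarrow> real" where
  "dist_cuntz2 x y = norm (x - y)"

definition sgn_cuntz2 :: "cuntz2 \<Rightarrow> cuntz2" where
  "sgn_cuntz2 x = inverse (norm x) *\<^sub>R x"

definition uniformity_cuntz2 :: "(cuntz2 \<times> cuntz2) filter" where
  "uniformity_cuntz2 = (INF e\<in>{0<..}. principal {(x, y). dist x y < e})"

definition open_cuntz2 :: "cuntz2 set \<Rightarrow> bool" where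
  "open_cuntz2 U \<longleftrightarrow> (\<forall>x\<in>U. eventually (\<lambda>(x', y). x' = x \<longrightarrow> y \<in> U) uniformity)"

lemma norm_cuntz2_lim:
  "cuntz_Cauchy X \<Longrightarrow> (\<lambda>n. cuntz_norm (X n)) \<longlonglongrightarrow> norm (abs_cuntz2 X)"
  using cuntz_Cauchy_norm[of X] by (simp add: norm_cuntz2.abs_eq convergent_LIMSEQ_iff)

lemma norm_cuntz2_eqI:
  "cuntz_Cauchy X \<Longrightarrow> (\<lambda>n. cuntz_norm (X n)) \<longlonglongrightarrow> l \<Longrightarrow> norm (abs_cuntz2 X) = l"
  using norm_cuntz2_lim LIMSEQ_unique by blast

instance
proof
  fix a :: real and x y :: cuntz2
  show "a *\<^sub>R x * y = a *\<^sub>R (x * y)" "x * a *\<^sub>R y = a *\<^sub>R (x * y)"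
    by (cases x; cases y; simp add: scaleR_cuntz2_def cuntz2_eqs fscale_mult fscale_central)+
  show "dist x y = norm (x - y)" by (rule dist_cuntz2_def)
  show "sgn x = x /\<^sub>R norm x" by (rule sgn_cuntz2_def)
  show "uniformity = (INF e\<in>{0<..}. principal {(x, y::cuntz2). dist x y < e})"
    by (rule uniformity_cuntz2_def)
  show "open U \<longleftrightarrow> (\<forall>x\<in>U. \<forall>\<^sub>F (x', y) in uniformity. x' = x \<longrightarrow> y \<in> U)" for U :: "cuntz2 set"
    by (rule open_cuntz2_def)
  show "norm (1::cuntz2) = 1"
    unfolding one_cuntz2.abs_eq by (rule norm_cuntz2_eqI) simp_all
  show "norm x = 0 \<longleftrightarrow> x = 0"
  proof (cases x)
    case (1 X)
    have "norm x = 0 \<longleftrightarrow> (\<lambda>n. cuntz_norm (X n)) \<longlonglongrightarrow> 0"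
      using norm_cuntz2_eqI norm_cuntz2_lim 1 by metis
    also have "\<dots> \<longleftrightarrow> x = 0"
      by (simp add: 1 cuntz2_eqs abs_cuntz2_eq) (simp add: cuntz_rel_def 1)
    finally show ?thesis .
  qed
  show "norm (x + y) \<le> norm x + norm y"
  proof (cases x; cases y)
    fix X Y assume *: "x = abs_cuntz2 X" "cuntz_Cauchy X" "y = abs_cuntz2 Y" "cuntz_Cauchy Y"
    show ?thesis
      using LIMSEQ_le[OF norm_cuntz2_lim[of "\<lambda>n. X n + Y n"]
          tendsto_add[OF norm_cuntz2_lim[of X] norm_cuntz2_lim[of Y]]] csn_add[OF cn]
      by (simp add: * cuntz2_eqs)
  qed
  show "norm (a *\<^sub>R x) = \<bar>a\<bar> * norm x"
  proof (cases x)
    case (1 X)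
    then show ?thesis
      by (auto simp: scaleR_cuntz2_def cuntz2_eqs intro!: norm_cuntz2_eqI tendsto_mult_left norm_cuntz2_lim)
  qed
  show "norm (x * y) \<le> norm x * norm y"
  proof (cases x; cases y)
    fix X Y assume *: "x = abs_cuntz2 X" "cuntz_Cauchy X" "y = abs_cuntz2 Y" "cuntz_Cauchy Y"
    show ?thesis
      using LIMSEQ_le[OF norm_cuntz2_lim[of "\<lambda>n. X n * Y n"]
          tendsto_mult[OF norm_cuntz2_lim[of X] norm_cuntz2_lim[of Y]]] csn_mult[OF cn]
      by (simp add: * cuntz2_eqs)
  qed
qed

end

definition of_free :: "free_alg \<Rightarrow> cuntz2" where
  "of_free f = abs_cuntz2 (\<lambda>n. f)"

lemma norm_of_free [simp]: "norm (of_free f) = cuntz_norm f"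
  unfolding of_free_def by (rule norm_cuntz2_eqI) simp_all

lemma of_free_hom:
  "of_free (f + g) = of_free f + of_free g"
  "of_free (f - g) = of_free f - of_free g"
  "of_free (f * g) = of_free f * of_free g"
  "of_free (fscale c f) = c *\<^sub>C of_free f"
  "of_free (fstar f) = star (of_free f)"
  "of_free 1 = 1" "of_free 0 = 0"
  by (simp_all add: of_free_def cuntz2_eqs)

lemma of_free_tendsto:
  assumes X: "cuntz_Cauchy X"
  shows "(\<lambda>n. of_free (X n)) \<longlonglongrightarrow> abs_cuntz2 X"
proof (rule metric_LIMSEQ_I)
  fix e :: real assume "0 < e"
  then have "0 < e / 2" by simp
  then obtain M where M: "\<And>m n. m \<ge> M \<Longrightarrow> n \<ge> M \<Longrightarrow> cuntz_norm (X m - X n) < e / 2"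
    using X unfolding cuntz_Cauchy_def by metis
  have "dist (of_free (X m)) (abs_cuntz2 X) < e" if m: "m \<ge> M" for m
  proof -
    have "of_free (X m) - abs_cuntz2 X = abs_cuntz2 (\<lambda>n. X m - X n)"
      by (simp add: of_free_def cuntz2_eqs X)
    moreover have "norm (abs_cuntz2 (\<lambda>n. X m - X n)) \<le> e / 2"
      by (rule LIMSEQ_le_const2[OF norm_cuntz2_lim]) (use X M m in \<open>auto intro!: exI[of _ M] less_imp_le\<close>)
    ultimately show ?thesis using \<open>0 < e\<close> by (simp add: dist_norm)
  qed
  then show "\<exists>M. \<forall>m\<ge>M. dist (of_free (X m)) (abs_cuntz2 X) < e" by blast
qed

lemma of_free_dense: "\<exists>f. norm (x - of_free f) < e" if "0 < e"
proof (cases x)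
  case (1 X)
  then have "\<exists>M. \<forall>m\<ge>M. dist (of_free (X m)) x < e"
    using metric_LIMSEQ_D[OF of_free_tendsto that] by simp
  then show ?thesis by (metis dist_commute dist_norm order_refl)
qed

instance cuntz2 :: banach
proof
  fix A :: "nat \<Rightarrow> cuntz2" assume A: "Cauchy A"
  have "\<forall>n. \<exists>f. norm (A n - of_free f) < inverse (real (Suc n))" by (simp add: of_free_dense)
  then obtain F where F: "\<And>n. norm (A n - of_free (F n)) < inverse (real (Suc n))" by metis
  have null: "(\<lambda>n. A n - of_free (F n)) \<longlonglongrightarrow> 0"
    by (rule Lim_null_comparison[OF _ LIMSEQ_inverse_real_of_nat]) (use F in \<open>auto intro!: always_eventually less_imp_le\<close>)
  have CF: "Cauchy (\<lambda>n. of_free (F n))"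
  proof (rule CauchyI)
    fix e :: real assume "0 < e"
    then have e: "0 < e / 3" by simp
    obtain M where M: "\<And>m n. m \<ge> M \<Longrightarrow> n \<ge> M \<Longrightarrow> norm (A m - A n) < e / 3"
      using CauchyD[OF A e] by blast
    obtain L where L: "\<And>n. n \<ge> L \<Longrightarrow> norm (A n - of_free (F n)) < e / 3"
      using LIMSEQ_D[OF null e] by auto
    have "norm (of_free (F m) - of_free (F n)) < e" if "m \<ge> max M L" "n \<ge> max M L" for m n
    proof -
      have eq: "of_free (F m) - of_free (F n)
          = (A m - A n) - (A m - of_free (F m)) + (A n - of_free (F n))"
        by simp
      have "norm (of_free (F m) - of_free (F n))
          \<le> norm (A m - A n) + norm (A m - of_free (F m)) + norm (A n - of_free (F n))"
        unfolding eq by (rule norm_triangle_le, rule add_right_mono, rule norm_triangle_ineq4)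
      then show ?thesis using M[of m n] L[of m] L[of n] that by simp
    qed
    then show "\<exists>M. \<forall>m\<ge>M. \<forall>n\<ge>M. norm (of_free (F m) - of_free (F n)) < e" by blast
  qed
  have "cuntz_Cauchy F"
    using CF by (simp add: Cauchy_iff cuntz_Cauchy_def flip: of_free_hom)
  from tendsto_add[OF null of_free_tendsto[OF this]] show "convergent A"
    by (auto simp: convergent_def)
qed

instance cuntz2 :: cstar_algebra_1
proof
  fix c d :: complex and x y :: cuntz2 and r :: real
  show "c *\<^sub>C (x + y) = c *\<^sub>C x + c *\<^sub>C y"
    by (cases x; cases y) (simp add: cuntz2_eqs fscale_add_right)
  show "(c + d) *\<^sub>C x = c *\<^sub>C x + d *\<^sub>C x" by (cases x) (simp add: cuntz2_eqs fscale_add_left)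
  show "c *\<^sub>C d *\<^sub>C x = (c * d) *\<^sub>C x" by (cases x) (simp add: cuntz2_eqs fscale_fscale)
  show "r *\<^sub>R x = complex_of_real r *\<^sub>C x" by (rule scaleR_cuntz2_def)
  show "(c *\<^sub>C x) * y = c *\<^sub>C (x * y)" "x * (c *\<^sub>C y) = c *\<^sub>C (x * y)"
    by (cases x; cases y; simp add: cuntz2_eqs fscale_mult fscale_central)+
  show "norm (c *\<^sub>C x) = cmod c * norm x"
    by (cases x) (auto simp: cuntz2_eqs intro!: norm_cuntz2_eqI tendsto_mult_left norm_cuntz2_lim)
  show "star (star x) = x" by (cases x) (simp add: cuntz2_eqs)
  show "star (x + y) = star x + star y" by (cases x; cases y) (simp add: cuntz2_eqs fstar_add)
  show "star (c *\<^sub>C x) = cnj c *\<^sub>C star x" by (cases x) (simp add: cuntz2_eqs fstar_fscale)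
  show "star (x * y) = star y * star x" by (cases x; cases y) (simp add: cuntz2_eqs fstar_mult)
  show "norm (star x * x) = (norm x)\<^sup>2"
    by (cases x) (auto simp: cuntz2_eqs intro!: norm_cuntz2_eqI tendsto_power norm_cuntz2_lim)
qed

subsection \<open>Generators and universal property\<close>

definition cuntz_S :: "index \<Rightarrow> cuntz2" where
  "cuntz_S i = of_free (gen i)"

text \<open>Pairs of isometries with \<open>T\<^sub>1 T\<^sub>1\<^sup>* + T\<^sub>2 T\<^sub>2\<^sup>* = 1\<close>.\<close>

definition cuntz_family :: "(index \<Rightarrow> 'a::cstar_algebra_1) \<Rightarrow> bool" where
  "cuntz_family T \<longleftrightarrow> (\<forall>i. isometry_elt (T i)) \<and> T I1 * star (T I1) + T I2 * star (T I2) = 1"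

lemma cuntz_family_S: "cuntz_family cuntz_S"
proof -
  have "norm (star (cuntz_S i) * cuntz_S i - 1) = 0" for i
    by (simp add: cuntz_S_def flip: of_free_hom)
  moreover have "norm (cuntz_S I1 * star (cuntz_S I1) + cuntz_S I2 * star (cuntz_S I2) - 1) = 0"
    by (simp add: cuntz_S_def flip: of_free_hom)
  ultimately show ?thesis by (simp add: cuntz_family_def isometry_elt_def)
qed

fun eval_letter :: "(index \<Rightarrow> 'a::cstar_algebra_1) \<Rightarrow> letter \<Rightarrow> 'a" where
  "eval_letter T (Gen i) = T i"
| "eval_letter T (Adj i) = star (T i)"

fun eval_word :: "(index \<Rightarrow> 'a::cstar_algebra_1) \<Rightarrow> word \<Rightarrow> 'a" where
  "eval_word T (Word u) = prod_list (List.map (eval_letter T) u)"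

definition eval_free :: "(index \<Rightarrow> 'a::cstar_algebra_1) \<Rightarrow> free_alg \<Rightarrow> 'a" where
  "eval_free T f = lin scaleC (eval_word T) f"

lemma eval_word_plus: "eval_word T (v + w) = eval_word T v * eval_word T w"
  by (cases v; cases w) simp

lemma eval_word_zero [simp]: "eval_word T 0 = 1"
  by (simp add: zero_word_def)

lemma eval_word_adj: "eval_word T (adj_word w) = star (eval_word T w)"
proof -
  have l: "eval_letter T (adj_letter l) = star (eval_letter T l)" for l
    by (cases l) (simp_all add: star_star)
  have "eval_word T (adj_word (Word u)) = star (eval_word T (Word u))" for u
    by (induction u) (simp_all add: star_mult l)
  then show ?thesis by (cases w) metis
qed

lemma eval_free_zero [simp]: "eval_free T 0 = 0"
  by (simp add: eval_free_def)

lemma eval_free_single: "eval_free T (Poly_Mapping.single w c) = c *\<^sub>C eval_word T w"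
  by (simp add: eval_free_def lin_single)

lemma eval_free_add: "eval_free T (f + g) = eval_free T f + eval_free T g"
  unfolding eval_free_def by (rule lin_add) (simp_all add: scaleC_add_left)

lemma eval_free_diff: "eval_free T (f - g) = eval_free T f - eval_free T g"
  using eval_free_add[of T "f - g" g] by simp

lemma eval_free_mult: "eval_free T (f * g) = eval_free T f * eval_free T g"
proof (induction f rule: free_induct)
  case (single w c)
  show ?case
    by (induction g rule: free_induct)
      (simp_all add: mult_single eval_free_single eval_word_plus mult_scaleC_left mult_scaleC_right
        scaleC_scaleC distrib_left eval_free_add mult.commute[of c])
qed (simp_all add: distrib_right eval_free_add)

lemma eval_free_one [simp]: "eval_free T 1 = 1"
  using eval_free_single[of T 0 1] by (simp add: scaleC_one)

lemma eval_free_scale: "eval_free T (fscale c f) = c *\<^sub>C eval_free T f"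
  by (simp add: fscale_def eval_free_mult eval_free_single mult_scaleC_left)

lemma eval_free_star: "eval_free T (fstar f) = star (eval_free T f)"
  by (induction f rule: free_induct)
    (simp_all add: eval_free_single eval_word_adj star_scaleC fstar_add eval_free_add star_add)

lemma eval_free_gen [simp]: "eval_free T (gen i) = T i"
  by (simp add: gen_def eval_free_single scaleC_one)

lemma norm_eval_free_le:
  assumes "cuntz_family T"
  shows "norm (eval_free T f) \<le> cuntz_norm f"
proof -
  have "cuntz_seminorm (\<lambda>f. norm (eval_free T f))"
    using assms
    by (simp add: cuntz_seminorm_def eval_free_add eval_free_scale eval_free_mult eval_free_star
        eval_free_diff norm_triangle_ineq norm_scaleC norm_mult_ineq cstar_identity
        cuntz_family_def isometry_elt_def)
  from cuntz_norm_upper[OF this, of f] show ?thesis by simp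
qed

definition cuntz_ext :: "(index \<Rightarrow> 'a::cstar_algebra_1) \<Rightarrow> cuntz2 \<Rightarrow> 'a" where
  "cuntz_ext T x = lim (\<lambda>n. eval_free T (rep_cuntz2 x n))"

lemma cuntz_ext_tendsto:
  assumes T: "cuntz_family T" and X: "cuntz_Cauchy X"
  shows "(\<lambda>n. eval_free T (X n)) \<longlonglongrightarrow> cuntz_ext T (abs_cuntz2 X)"
proof -
  let ?R = "rep_cuntz2 (abs_cuntz2 X)"
  have R: "cuntz_rel ?R X"
    by (metis Quotient3_cuntz2 X abs_cuntz2_eq Quotient3_abs_rep Quotient3_rep_reflp cuntz_rel_refl)
  then have CR: "cuntz_Cauchy ?R" by (simp add: cuntz_rel_def)
  have "Cauchy (\<lambda>n. eval_free T (?R n))"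
  proof (rule CauchyI)
    fix e :: real assume "0 < e"
    then obtain M where "\<forall>m\<ge>M. \<forall>n\<ge>M. cuntz_norm (?R m - ?R n) < e"
      using CR unfolding cuntz_Cauchy_def by blast
    then show "\<exists>M. \<forall>m\<ge>M. \<forall>n\<ge>M. norm (eval_free T (?R m) - eval_free T (?R n)) < e"
      using norm_eval_free_le[OF T] by (metis eval_free_diff le_less_trans)
  qed
  then have l: "(\<lambda>n. eval_free T (?R n)) \<longlonglongrightarrow> cuntz_ext T (abs_cuntz2 X)"
    unfolding cuntz_ext_def using Cauchy_convergent convergent_LIMSEQ_iff by blast
  have "(\<lambda>n. eval_free T (?R n) - eval_free T (X n)) \<longlonglongrightarrow> 0"
    by (rule Lim_null_comparison[of _ "\<lambda>n. cuntz_norm (?R n - X n)"])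
      (use R norm_eval_free_le[OF T] in \<open>auto simp: cuntz_rel_def simp flip: eval_free_diff\<close>)
  from tendsto_diff[OF l this] show ?thesis by simp
qed

lemma cuntz_ext_eqI:
  assumes "cuntz_family T" "cuntz_Cauchy X" "(\<lambda>n. eval_free T (X n)) \<longlonglongrightarrow> y"
  shows "cuntz_ext T (abs_cuntz2 X) = y"
  using LIMSEQ_unique[OF cuntz_ext_tendsto[OF assms(1,2)] assms(3)] .

lemma bounded_linear_scaleC: "bounded_linear (\<lambda>x::'a::cstar_algebra_1. c *\<^sub>C x)"
  by (rule bounded_linear_intro[where K="cmod c"])
    (simp_all add: scaleC_add_right norm_scaleC scaleR_scaleC scaleC_scaleC mult.commute)

lemma cuntz_ext_hom:
  assumes T: "cuntz_family T"
  shows "unital_star_hom (cuntz_ext T)"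
  unfolding unital_star_hom_def
proof (intro conjI allI)
  note lim = cuntz_ext_tendsto[OF T]
  fix x y :: cuntz2 and c
  obtain X where X: "x = abs_cuntz2 X" "cuntz_Cauchy X" by (cases x)
  obtain Y where Y: "y = abs_cuntz2 Y" "cuntz_Cauchy Y" by (cases y)
  show "cuntz_ext T (x + y) = cuntz_ext T x + cuntz_ext T y"
    using X Y by (auto simp: cuntz2_eqs eval_free_add intro!: cuntz_ext_eqI T tendsto_add lim)
  show "cuntz_ext T (x * y) = cuntz_ext T x * cuntz_ext T y"
    using X Y by (auto simp: cuntz2_eqs eval_free_mult intro!: cuntz_ext_eqI T tendsto_mult lim)
  show "cuntz_ext T (c *\<^sub>C x) = c *\<^sub>C cuntz_ext T x"
    using X by (auto simp: cuntz2_eqs eval_free_scale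
        intro!: cuntz_ext_eqI T bounded_linear.tendsto[OF bounded_linear_scaleC] lim)
  show "cuntz_ext T (star x) = star (cuntz_ext T x)"
    using X by (auto simp: cuntz2_eqs eval_free_star
        intro!: cuntz_ext_eqI T bounded_linear.tendsto[OF bounded_linear_star] lim)
  show "cuntz_ext T 1 = 1"
    by (auto simp: cuntz2_eqs intro!: cuntz_ext_eqI T)
qed

lemma cuntz_ext_S: "cuntz_family T \<Longrightarrow> cuntz_ext T (cuntz_S i) = T i"
  unfolding cuntz_S_def of_free_def by (rule cuntz_ext_eqI) auto

lemma hom_of_free:
  assumes "unital_star_hom \<phi>"
  shows "\<phi> (of_free f) = eval_free (\<lambda>i. \<phi> (cuntz_S i)) f"
proof -
  have add: "\<phi> (x + y) = \<phi> x + \<phi> y" and sc: "\<phi> (c *\<^sub>C x) = c *\<^sub>C \<phi> x" and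
    mul: "\<phi> (x * y) = \<phi> x * \<phi> y" and st: "\<phi> (star x) = star (\<phi> x)" and one: "\<phi> 1 = 1" for x y c
    using assms by (auto simp: unital_star_hom_def)
  have zero: "\<phi> 0 = 0" using add[of 0 0] by simp
  have word: "\<phi> (of_free (Poly_Mapping.single (Word u) 1)) = eval_word (\<lambda>i. \<phi> (cuntz_S i)) (Word u)" for u
  proof (induction u)
    case Nil
    then show ?case by (simp flip: zero_word_def add: of_free_hom one)
  next
    case (Cons l u)
    have l: "\<phi> (of_free (Poly_Mapping.single (Word [l]) 1)) = eval_letter (\<lambda>i. \<phi> (cuntz_S i)) l"
    proof (cases l)
      case (Gen i)
      then show ?thesis by (simp add: cuntz_S_def gen_def)
    next
      case (Adj i)
      then have "Poly_Mapping.single (Word [l]) 1 = fstar (gen i)" by (simp add: gen_def)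
      then show ?thesis by (simp add: Adj cuntz_S_def of_free_hom st)
    qed
    have "Poly_Mapping.single (Word (l # u)) 1 =
      Poly_Mapping.single (Word [l]) (1::complex) * Poly_Mapping.single (Word u) 1"
      by (simp add: mult_single)
    then show ?case using Cons l by (simp add: of_free_hom mul)
  qed
  show ?thesis
  proof (induction f rule: free_induct)
    case (single w c)
    have "Poly_Mapping.single w c = fscale c (Poly_Mapping.single w 1)" by (simp add: fscale_single)
    moreover obtain u where "w = Word u" by (cases w)
    ultimately show ?case
      using word[of u] by (simp only: of_free_hom sc eval_free_scale eval_free_single scaleC_one)
  qed (simp_all add: of_free_hom zero add eval_free_add)
qed

theorem cuntz2_universal:
  fixes T :: "index \<Rightarrow> 'a::cstar_algebra_1"
  assumes "cuntz_family T"
  shows "\<exists>!\<phi>. unital_star_hom \<phi> \<and> (\<forall>i. \<phi> (cuntz_S i) = T i)"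
proof (rule ex1I)
  show "unital_star_hom (cuntz_ext T) \<and> (\<forall>i. cuntz_ext T (cuntz_S i) = T i)"
    using assms by (simp add: cuntz_ext_hom cuntz_ext_S)
next
  fix \<phi> :: "cuntz2 \<Rightarrow> 'a" assume \<phi>: "unital_star_hom \<phi> \<and> (\<forall>i. \<phi> (cuntz_S i) = T i)"
  have diff: "\<phi> (x - y) = \<phi> x - \<phi> y" for x y
    using \<phi> unfolding unital_star_hom_def by (metis add_diff_cancel diff_add_cancel)
  show "\<phi> = cuntz_ext T"
  proof
    fix x
    obtain X where X: "x = abs_cuntz2 X" "cuntz_Cauchy X" by (cases x)
    have null: "(\<lambda>n. of_free (X n) - x) \<longlonglongrightarrow> 0"
      using of_free_tendsto[OF X(2)] X(1) by (simp add: LIM_zero_iff)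
    have "(\<lambda>n. \<phi> (of_free (X n)) - \<phi> x) \<longlonglongrightarrow> 0"
      by (rule Lim_null_comparison[OF _ tendsto_norm_zero[OF null]])
        (simp add: unital_star_hom_norm_le \<phi> flip: diff)
    then have "(\<lambda>n. eval_free T (X n)) \<longlonglongrightarrow> \<phi> x"
      using hom_of_free[of \<phi>] \<phi> by (simp add: LIM_zero_iff)
    then show "\<phi> x = cuntz_ext T x"
      using cuntz_ext_eqI[OF assms X(2)] X(1) by metis
  qed
qed

subsection \<open>The UHF-subalgebra and the endomorphisms \<open>\<lambda>\<^sub>v\<close>\<close>

definition cuntz_monomial :: "index list \<Rightarrow> cuntz2" where
  "cuntz_monomial \<mu> = prod_list (List.map cuntz_S \<mu>)"

text \<open>Closed complex linear span of the \<open>S\<^sub>\<mu> S\<^sub>\<nu>\<^sup>*\<close> over multi-indices of equal length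
  (the empty ones give \<open>1\<close>).\<close>

definition F2 :: "cuntz2 set" where
  "F2 = closure (module.span scaleC
     {cuntz_monomial \<mu> * star (cuntz_monomial \<nu>) | \<mu> \<nu>. length \<mu> = length \<nu>})"

text \<open>For unitary \<open>v\<close> the description is satisfied by exactly one map, by \<open>cuntz2_universal\<close>;
  see lemma \<open>cuntz_endo\<close>.\<close>

definition cuntz_endo :: "cuntz2 \<Rightarrow> cuntz2 \<Rightarrow> cuntz2" where
  "cuntz_endo v = (THE \<phi>. unital_star_hom \<phi> \<and> (\<forall>i. \<phi> (cuntz_S i) = v * cuntz_S i))"

lemma cuntz_endo:
  assumes "unitary_elt v"
  shows "unital_star_hom (cuntz_endo v)" "cuntz_endo v (cuntz_S i) = v * cuntz_S i"
proof -
  have v: "star v * (v * x) = x" "v * star v = 1" for x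
    using assms by (simp_all add: unitary_elt_def flip: mult.assoc)
  have S: "star (cuntz_S i) * cuntz_S i = 1"
    "cuntz_S I1 * star (cuntz_S I1) + cuntz_S I2 * star (cuntz_S I2) = 1" for i
    using cuntz_family_S by (simp_all add: cuntz_family_def isometry_elt_def)
  have "v * (cuntz_S I1 * star (cuntz_S I1) + cuntz_S I2 * star (cuntz_S I2)) * star v = 1"
    by (simp add: S v)
  then have "v * (cuntz_S I1 * (star (cuntz_S I1) * star v)) + v * (cuntz_S I2 * (star (cuntz_S I2) * star v)) = 1"
    by (simp only: mult.assoc distrib_left distrib_right)
  then have "cuntz_family (\<lambda>i. v * cuntz_S i)"
    by (simp add: cuntz_family_def isometry_elt_def star_mult S v mult.assoc)
  from theI'[OF cuntz2_universal[OF this], folded cuntz_endo_def]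
  show "unital_star_hom (cuntz_endo v)" "cuntz_endo v (cuntz_S i) = v * cuntz_S i" by auto
qed

end

theory Submission
  imports Defs
begin

text \<open>The isometries \<open>T\<^sub>1 = S\<^sub>1\<close>, \<open>T\<^sub>2 = S\<^sub>2 S\<^sub>1\<close>, \<open>T\<^sub>3 = S\<^sub>2 S\<^sub>2\<close> have
  range projections summing to \<open>1\<close>, so
  \<open>\<rho>(x) = \<Sum>\<^sub>j T\<^sub>j x T\<^sub>j\<^sup>*\<close> is a unital *-endomorphism of \<open>\<O>\<^sub>2\<close>. It sends
  \<open>S\<^sub>\<mu> S\<^sub>\<nu>\<^sup>*\<close> to a sum of such products in which both multi-indices are
  prolonged by the same prefix, so it maps \<open>\<F>\<^sub>2\<close> into itself. Its range commutes with all
  \<open>T\<^sub>j T\<^sub>k\<^sup>*\<close>, hence with the unitary \<open>d\<close> that exchanges \<open>T\<^sub>1\<close> and \<open>T\<^sub>2\<close> and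
  fixes \<open>T\<^sub>3\<close>. Because \<open>T\<^sub>1\<close> and \<open>T\<^sub>2\<close> have different lengths, \<open>d\<close> does not
  lie in \<open>\<F>\<^sub>2\<close>.

  The endomorphism \<open>\<rho>\<close> is \<open>\<lambda>\<^sub>u\<close> for
  \<open>u = \<Sum>\<^sub>i \<rho>(S\<^sub>i) S\<^sub>i\<^sup>*\<close>. Put \<open>v = d u\<close>. Then
  \<open>\<lambda>\<^sub>v(S\<^sub>\<mu>) = d\<^sup>k \<rho>(S\<^sub>\<mu>)\<close> for \<open>\<mu>\<close> of length \<open>k\<close>, and in
  \<open>\<lambda>\<^sub>v(S\<^sub>\<mu> S\<^sub>\<nu>\<^sup>*)\<close> with multi-indices of equal length the powers of \<open>d\<close>
  cancel: \<open>\<lambda>\<^sub>v\<close> and \<open>\<rho>\<close> agree on \<open>\<F>\<^sub>2\<close>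
  (lemma \<open>cuntz_endo_twisted_eq_amplify\<close>).

  Finally \<open>v \<notin> \<F>\<^sub>2\<close>: the gauge involution \<open>S\<^sub>i \<mapsto> - S\<^sub>i\<close> fixes \<open>\<F>\<^sub>2\<close>
  pointwise, so it would fix \<open>v\<close> and hence the product \<open>S\<^sub>1\<^sup>* v S\<^sub>1 S\<^sub>2 S\<^sub>1\<close>,
  whose four generators contribute an even number of signs; but that product equals \<open>S\<^sub>1\<close>.\<close>

section \<open>Unitaries and Cuntz families\<close>

lemma unitary_elt_mult:
  assumes "unitary_elt a" "unitary_elt b"
  shows "unitary_elt (a * b)"
proof -
  have "star b * (star a * a) * b = 1" "a * (b * star b) * star a = 1"
    using assms by (simp_all add: unitary_elt_def)
  then show ?thesis by (simp add: unitary_elt_def star_mult mult.assoc)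
qed

lemma unitary_elt_power: "unitary_elt d \<Longrightarrow> unitary_elt (d ^ k)"
  by (induction k) (simp_all add: unitary_elt_mult, simp add: unitary_elt_def)

lemma star_sum: "star (sum f A) = (\<Sum>a\<in>A. star (f a :: 'a::cstar_algebra_1))"
  by (induction A rule: infinite_finite_induct) (simp_all add: star_add)

text \<open>Expanding \<open>T\<^sub>1\<^sup>* (T\<^sub>1 T\<^sub>1\<^sup>* + T\<^sub>2 T\<^sub>2\<^sup>*) T\<^sub>2\<close> gives \<open>T\<^sub>1\<^sup>* T\<^sub>2\<close> twice.\<close>

lemma cuntz_family_orthogonal:
  assumes "cuntz_family T"
  shows "star (T i) * T j = (if i = j then 1 else 0)"
proof -
  have iso: "star (T i) * T i = 1" for i
    using assms by (simp add: cuntz_family_def isometry_elt_def)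
  let ?x = "star (T I1) * T I2"
  have "?x = star (T I1) * (T I1 * star (T I1) + T I2 * star (T I2)) * T I2"
    using assms by (simp add: cuntz_family_def)
  also have "\<dots> = (star (T I1) * T I1) * ?x + ?x * (star (T I2) * T I2)"
    by (simp only: distrib_left distrib_right mult.assoc)
  finally have x: "?x = 0" by (simp add: iso)
  then have "star ?x = 0" by simp
  then have "star (T I2) * T I1 = 0" by (simp add: star_mult star_star)
  with x iso show ?thesis by (cases i; cases j) simp_all
qed

text \<open>The unitary is \<open>\<Sum>\<^sub>i R\<^sub>i S\<^sub>i\<^sup>*\<close>. This is the correspondence between unital
  *-endomorphisms \<open>S\<^sub>i \<mapsto> R\<^sub>i\<close> of \<open>\<O>\<^sub>2\<close> and unitaries.\<close>

lemma cuntz_family_unitary: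
  fixes R :: "index \<Rightarrow> cuntz2"
  assumes R: "cuntz_family R"
  obtains u where "unitary_elt u" "\<And>i. u * cuntz_S i = R i"
proof -
  define u where "u = R I1 * star (cuntz_S I1) + R I2 * star (cuntz_S I2)"
  have su: "star u = cuntz_S I1 * star (R I1) + cuntz_S I2 * star (R I2)"
    by (simp add: u_def star_add star_mult star_star)
  have uS: "u * cuntz_S i = R i" for i
    by (cases i) (simp_all add: u_def distrib_right mult.assoc cuntz_family_orthogonal[OF cuntz_family_S])
  have uR: "star u * R i = cuntz_S i" for i
    by (cases i) (simp_all add: su distrib_right mult.assoc cuntz_family_orthogonal[OF R])
  have "star u * u = star u * R I1 * star (cuntz_S I1) + star u * R I2 * star (cuntz_S I2)"
    by (simp add: u_def distrib_left mult.assoc)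
  also have "\<dots> = 1" using cuntz_family_S by (simp add: uR cuntz_family_def)
  finally have 1: "star u * u = 1" .
  have "u * star u = u * cuntz_S I1 * star (R I1) + u * cuntz_S I2 * star (R I2)"
    by (simp add: su distrib_left mult.assoc)
  also have "\<dots> = 1" using R by (simp add: uS cuntz_family_def)
  finally show thesis using 1 uS that by (auto simp: unitary_elt_def)
qed

section \<open>The endomorphism of a complete orthogonal system of isometries\<close>

definition isometry_system :: "'i set \<Rightarrow> ('i \<Rightarrow> 'a::cstar_algebra_1) \<Rightarrow> bool" where
  "isometry_system I T \<longleftrightarrow> finite I \<and>
     (\<forall>i\<in>I. \<forall>j\<in>I. star (T i) * T j = (if i = j then 1 else 0)) \<and>
     (\<Sum>i\<in>I. T i * star (T i)) = 1"

definition amplify :: "'i set \<Rightarrow> ('i \<Rightarrow> 'a::cstar_algebra_1) \<Rightarrow> 'a \<Rightarrow> 'a" where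
  "amplify I T x = (\<Sum>i\<in>I. T i * x * star (T i))"

text \<open>The permutation matrix of \<open>\<sigma>\<close> with respect to the matrix units
  \<open>T\<^sub>i T\<^sub>j\<^sup>*\<close>.\<close>

definition perm_unitary :: "'i set \<Rightarrow> ('i \<Rightarrow> 'a::cstar_algebra_1) \<Rightarrow> ('i \<Rightarrow> 'i) \<Rightarrow> 'a" where
  "perm_unitary I T \<sigma> = (\<Sum>i\<in>I. T (\<sigma> i) * star (T i))"

context
  fixes I :: "'i set" and T :: "'i \<Rightarrow> 'a::cstar_algebra_1"
  assumes T: "isometry_system I T"
begin

lemma system_finite: "finite I"
  and system_sum: "(\<Sum>i\<in>I. T i * star (T i)) = 1"
  using T by (simp_all add: isometry_system_def)

lemma system_orthogonal: "i \<in> I \<Longrightarrow> j \<in> I \<Longrightarrow> star (T i) * T j = (if i = j then 1 else 0)"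
  using T by (simp add: isometry_system_def)

lemma system_collapse:
  assumes "j \<in> I"
  shows "(\<Sum>i\<in>I. f i * star (T i)) * T j = f j"
proof -
  have "(\<Sum>i\<in>I. f i * star (T i)) * T j = (\<Sum>i\<in>I. f i * (star (T i) * T j))"
    by (simp add: sum_distrib_right mult.assoc)
  also have "\<dots> = (\<Sum>i\<in>I. if i = j then f i else 0)"
    using assms by (intro sum.cong) (auto simp: system_orthogonal)
  also have "\<dots> = f j" using assms system_finite by simp
  finally show ?thesis .
qed

lemma amplify_mult_isometry: "j \<in> I \<Longrightarrow> amplify I T x * T j = T j * x"
  unfolding amplify_def by (rule system_collapse)

lemma amplify_mult: "amplify I T x * amplify I T y = amplify I T (x * y)"
proof -
  have "amplify I T x * amplify I T y = (\<Sum>i\<in>I. amplify I T x * T i * (y * star (T i)))"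
    by (simp add: amplify_def[of _ _ y] sum_distrib_left mult.assoc)
  also have "\<dots> = amplify I T (x * y)"
    unfolding amplify_def[of _ _ "x * y"]
    by (rule sum.cong) (simp_all add: amplify_mult_isometry mult.assoc)
  finally show ?thesis .
qed

lemma amplify_add: "amplify I T (x + y) = amplify I T x + amplify I T y"
  by (simp add: amplify_def distrib_left distrib_right sum.distrib)

lemma amplify_star: "amplify I T (star x) = star (amplify I T x)"
  by (simp add: amplify_def star_sum star_mult star_star mult.assoc)

lemma amplify_one: "amplify I T 1 = 1"
  by (simp add: amplify_def system_sum)

lemma cuntz_family_amplify:
  assumes "cuntz_family R"
  shows "cuntz_family (\<lambda>i. amplify I T (R i))"
  using assms
  by (simp add: cuntz_family_def isometry_elt_def amplify_mult amplify_one
      flip: amplify_star amplify_add)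

lemma perm_unitary_isometry: "j \<in> I \<Longrightarrow> perm_unitary I T \<sigma> * T j = T (\<sigma> j)"
  unfolding perm_unitary_def by (rule system_collapse)

lemma unitary_perm_unitary:
  assumes \<sigma>: "bij_betw \<sigma> I I"
  shows "unitary_elt (perm_unitary I T \<sigma>)"
proof -
  let ?d = "perm_unitary I T \<sigma>"
  have mem: "\<sigma> i \<in> I" if "i \<in> I" for i using \<sigma> that by (rule bij_betw_apply)
  have sd: "star ?d = (\<Sum>i\<in>I. T i * star (T (\<sigma> i)))"
    by (simp add: perm_unitary_def star_sum star_mult star_star)
  have "?d * star ?d = (\<Sum>i\<in>I. ?d * T i * star (T (\<sigma> i)))"
    by (simp add: sd sum_distrib_left mult.assoc)
  also have "\<dots> = (\<Sum>i\<in>I. T (\<sigma> i) * star (T (\<sigma> i)))"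
    by (rule sum.cong) (simp_all add: perm_unitary_isometry)
  also have "\<dots> = (\<Sum>i\<in>I. T i * star (T i))"
    by (rule sum.reindex_bij_betw[OF \<sigma>])
  finally have 1: "?d * star ?d = 1" by (simp add: system_sum)
  have "star ?d * T (\<sigma> j) = T j" if "j \<in> I" for j
  proof -
    have "star ?d * T (\<sigma> j) = (\<Sum>i\<in>I. T i * (star (T (\<sigma> i)) * T (\<sigma> j)))"
      by (simp add: sd sum_distrib_right mult.assoc)
    also have "\<dots> = (\<Sum>i\<in>I. if i = j then T i else 0)"
      using that \<sigma> by (intro sum.cong)
        (auto simp: system_orthogonal mem dest: inj_onD[OF bij_betw_imp_inj_on])
    also have "\<dots> = T j" using that system_finite by simp
    finally show ?thesis .
  qed
  then have "star ?d * ?d = (\<Sum>i\<in>I. T i * star (T i))"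
    by (simp add: perm_unitary_def[of I T \<sigma>] sum_distrib_left flip: mult.assoc)
  with 1 show ?thesis by (simp add: unitary_elt_def system_sum)
qed

text \<open>Both products are \<open>\<Sum>\<^sub>i T\<^bsub>\<sigma>(i)\<^esub> x T\<^sub>i\<^sup>*\<close>.\<close>

lemma perm_unitary_commute:
  assumes "\<sigma> ` I \<subseteq> I"
  shows "perm_unitary I T \<sigma> * amplify I T x = amplify I T x * perm_unitary I T \<sigma>"
proof -
  have "perm_unitary I T \<sigma> * amplify I T x = (\<Sum>i\<in>I. perm_unitary I T \<sigma> * T i * (x * star (T i)))"
    by (simp add: amplify_def sum_distrib_left mult.assoc)
  also have "\<dots> = (\<Sum>i\<in>I. T (\<sigma> i) * (x * star (T i)))"
    by (rule sum.cong) (simp_all add: perm_unitary_isometry)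
  also have "\<dots> = (\<Sum>i\<in>I. amplify I T x * T (\<sigma> i) * star (T i))"
    using assms by (intro sum.cong)
      (simp_all add: amplify_mult_isometry image_subset_iff, simp add: mult.assoc)
  also have "\<dots> = amplify I T x * perm_unitary I T \<sigma>"
    by (simp add: perm_unitary_def sum_distrib_left mult.assoc)
  finally show ?thesis .
qed

end

section \<open>Homomorphisms on the UHF-subalgebra\<close>

lemma cuntz_monomial_Nil: "cuntz_monomial [] = 1"
  and cuntz_monomial_Cons: "cuntz_monomial (i # \<mu>) = cuntz_S i * cuntz_monomial \<mu>"
  and cuntz_monomial_append: "cuntz_monomial (\<mu> @ \<nu>) = cuntz_monomial \<mu> * cuntz_monomial \<nu>"
  by (simp_all add: cuntz_monomial_def)

lemma unital_star_hom_tendsto: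
  fixes \<phi> :: "'a::cstar_algebra_1 \<Rightarrow> 'b::cstar_algebra_1"
  assumes \<phi>: "unital_star_hom \<phi>" and x: "x \<longlonglongrightarrow> l"
  shows "(\<lambda>n. \<phi> (x n)) \<longlonglongrightarrow> \<phi> l"
proof -
  have "bounded_linear \<phi>"
    using \<phi> unital_star_hom_norm_le[OF \<phi>]
    by (intro bounded_linear_intro[where K=1]) (auto simp: unital_star_hom_def scaleR_scaleC)
  then show ?thesis using x by (rule bounded_linear.tendsto)
qed

interpretation scaleC: vector_space "scaleC :: complex \<Rightarrow> 'a::cstar_algebra_1 \<Rightarrow> 'a"
  by (rule vector_space_scaleC)

text \<open>Closed linear conditions on a *-homomorphism hold on \<open>\<F>\<^sub>2\<close> as soon as they hold on
  its spanning products. The closed subspace \<open>M\<close> of pairs covers both invariance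
  (take \<open>M = \<O>\<^sub>2 \<times> \<F>\<^sub>2\<close>) and fixed points (take the diagonal).\<close>

lemma F2_hom_induct:
  fixes \<phi> :: "cuntz2 \<Rightarrow> cuntz2" and M :: "(cuntz2 \<times> cuntz2) set"
  assumes \<phi>: "unital_star_hom \<phi>" and M: "closed M" "(0, 0) \<in> M"
    and add: "\<And>x y x' y'. (x, y) \<in> M \<Longrightarrow> (x', y') \<in> M \<Longrightarrow> (x + x', y + y') \<in> M"
    and scale: "\<And>c x y. (x, y) \<in> M \<Longrightarrow> (c *\<^sub>C x, c *\<^sub>C y) \<in> M"
    and gens: "\<And>\<mu> \<nu>. length \<mu> = length \<nu> \<Longrightarrow>
      (cuntz_monomial \<mu> * star (cuntz_monomial \<nu>), \<phi> (cuntz_monomial \<mu> * star (cuntz_monomial \<nu>))) \<in> M"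
    and x: "x \<in> F2"
  shows "(x, \<phi> x) \<in> M"
proof -
  have hom: "\<phi> (x + y) = \<phi> x + \<phi> y" "\<phi> (c *\<^sub>C x) = c *\<^sub>C \<phi> x" for x y c
    using \<phi> by (auto simp: unital_star_hom_def)
  have zero: "\<phi> 0 = 0" using hom(1)[of 0 0] by simp
  let ?G = "{cuntz_monomial \<mu> * star (cuntz_monomial \<nu>) | \<mu> \<nu>. length \<mu> = length \<nu>}"
  obtain X where X: "\<And>n. X n \<in> scaleC.span ?G" "X \<longlonglongrightarrow> x"
    using x unfolding F2_def closure_sequential by blast
  have sub: "scaleC.subspace {x. (x, \<phi> x) \<in> M}"
    by (rule scaleC.subspaceI) (simp_all only: mem_Collect_eq zero hom M(2) add scale)
  have "?G \<subseteq> {x. (x, \<phi> x) \<in> M}" using gens by auto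
  then have "scaleC.span ?G \<subseteq> {x. (x, \<phi> x) \<in> M}"
    using sub by (rule scaleC.span_minimal)
  then have "(X n, \<phi> (X n)) \<in> M" for n using X(1) by blast
  then show ?thesis
    by (rule closed_sequentially[OF M(1) _ tendsto_Pair[OF X(2) unital_star_hom_tendsto[OF \<phi> X(2)]]])
qed

lemma F2_monomial:
  assumes "length \<mu> = length \<nu>"
  shows "cuntz_monomial \<mu> * star (cuntz_monomial \<nu>) \<in> F2"
  unfolding F2_def
  by (rule subsetD[OF closure_subset], rule scaleC.span_base) (use assms in blast)

lemma closed_F2: "closed F2"
  by (simp add: F2_def)

lemma F2_zero: "0 \<in> F2"
  unfolding F2_def by (rule subsetD[OF closure_subset]) (rule scaleC.span_zero)

lemma F2_add: "x \<in> F2 \<Longrightarrow> y \<in> F2 \<Longrightarrow> x + y \<in> F2"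
  unfolding F2_def closure_sequential
  by (metis (no_types, lifting) scaleC.span_add tendsto_add)

lemma F2_scale: "x \<in> F2 \<Longrightarrow> c *\<^sub>C x \<in> F2"
  unfolding F2_def closure_sequential
  by (metis (no_types, lifting) scaleC.span_scale bounded_linear.tendsto[OF bounded_linear_scaleC])

lemma F2_sum: "(\<And>i. i \<in> A \<Longrightarrow> f i \<in> F2) \<Longrightarrow> sum f A \<in> F2"
  by (induction A rule: infinite_finite_induct) (simp_all add: F2_zero F2_add)

lemma F2_invariant:
  assumes "unital_star_hom \<phi>"
    and "\<And>\<mu> \<nu>. length \<mu> = length \<nu> \<Longrightarrow> \<phi> (cuntz_monomial \<mu> * star (cuntz_monomial \<nu>)) \<in> F2"
  shows "\<phi> ` F2 \<subseteq> F2"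
proof
  fix y assume "y \<in> \<phi> ` F2"
  then obtain x where x: "x \<in> F2" "y = \<phi> x" by blast
  have "(x, \<phi> x) \<in> UNIV \<times> F2"
    by (rule F2_hom_induct[OF assms(1) closed_Times[OF closed_UNIV closed_F2]])
      (use x assms(2) in \<open>auto simp: F2_zero F2_add F2_scale\<close>)
  with x show "y \<in> F2" by simp
qed

text \<open>The involution acts on a product of \<open>k\<close> generators as \<open>(- 1)\<^sup>k\<close>, and
  \<open>S\<^sub>\<mu> S\<^sub>\<nu>\<^sup>*\<close> involves an even number of them.\<close>

lemma gauge_involution_F2:
  assumes "x \<in> F2"
  shows "cuntz_endo (- 1) x = x"
proof -
  have "unitary_elt (- 1 :: cuntz2)" by (simp add: unitary_elt_def star_minus)
  note \<gamma> = cuntz_endo[OF this]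
  have hom: "cuntz_endo (- 1) (x * y) = cuntz_endo (- 1) x * cuntz_endo (- 1) y"
    "cuntz_endo (- 1) (star x) = star (cuntz_endo (- 1) x)" "cuntz_endo (- 1) 1 = 1" for x y
    using \<gamma>(1) by (auto simp: unital_star_hom_def)
  have mono: "cuntz_endo (- 1) (cuntz_monomial \<mu>) =
      (if even (length \<mu>) then cuntz_monomial \<mu> else - cuntz_monomial \<mu>)" for \<mu>
  proof (induction \<mu>)
    case Nil
    then show ?case by (simp add: cuntz_monomial_Nil hom(3))
  next
    case (Cons i \<mu>)
    then show ?case by (simp add: cuntz_monomial_Cons hom(1) \<gamma>(2))
  qed
  have gens: "cuntz_endo (- 1) (cuntz_monomial \<mu> * star (cuntz_monomial \<nu>)) =
      cuntz_monomial \<mu> * star (cuntz_monomial \<nu>)" if "length \<mu> = length \<nu>" for \<mu> \<nu>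
    using that by (simp add: hom(1,2) mono star_minus)
  have "(x, cuntz_endo (- 1) x) \<in> {p. fst p = snd p}"
  proof (rule F2_hom_induct[OF \<gamma>(1) _ _ _ _ _ assms])
    show "closed {p :: cuntz2 \<times> cuntz2. fst p = snd p}"
      by (intro closed_Collect_eq continuous_intros)
  qed (simp_all add: gens)
  then show ?thesis by simp
qed

section \<open>The twisted endomorphism\<close>

text \<open>Since \<open>d\<close> commutes with the range of \<open>\<rho>\<close>, a product of \<open>k\<close> factors
  \<open>d \<rho>(S\<^sub>i)\<close> is \<open>\<rho>(S\<^sub>\<mu>) d\<^sup>k\<close>. Multi-indices of equal length give the same
  power of \<open>d\<close> on both sides of \<open>S\<^sub>\<mu> S\<^sub>\<nu>\<^sup>*\<close>, and \<open>d\<^sup>k (d\<^sup>k)\<^sup>* = 1\<close>.\<close>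

lemma cuntz_endo_twisted_eq_amplify:
  assumes T: "isometry_system I T" and d: "unitary_elt d" and v: "unitary_elt v"
    and comm: "\<And>x. d * amplify I T x = amplify I T x * d"
    and vS: "\<And>i. v * cuntz_S i = d * amplify I T (cuntz_S i)"
    and len: "length \<mu> = length \<nu>"
  shows "cuntz_endo v (cuntz_monomial \<mu> * star (cuntz_monomial \<nu>)) =
    amplify I T (cuntz_monomial \<mu> * star (cuntz_monomial \<nu>))"
proof -
  let ?\<rho> = "amplify I T"
  note \<lambda> = cuntz_endo[OF v]
  have hom: "cuntz_endo v (x * y) = cuntz_endo v x * cuntz_endo v y"
    "cuntz_endo v (star x) = star (cuntz_endo v x)" "cuntz_endo v 1 = 1" for x y
    using \<lambda>(1) by (auto simp: unital_star_hom_def)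
  have mono: "cuntz_endo v (cuntz_monomial \<mu>) = ?\<rho> (cuntz_monomial \<mu>) * d ^ length \<mu>" for \<mu>
  proof (induction \<mu>)
    case Nil
    then show ?case by (simp add: cuntz_monomial_Nil hom amplify_one[OF T])
  next
    case (Cons i \<mu>)
    then have "cuntz_endo v (cuntz_monomial (i # \<mu>)) =
        ?\<rho> (cuntz_S i) * d * (?\<rho> (cuntz_monomial \<mu>) * d ^ length \<mu>)"
      by (simp only: cuntz_monomial_Cons hom \<lambda>(2) vS comm)
    also have "\<dots> = ?\<rho> (cuntz_S i) * (d * ?\<rho> (cuntz_monomial \<mu>)) * d ^ length \<mu>"
      by (simp only: mult.assoc)
    also have "\<dots> = (?\<rho> (cuntz_S i) * ?\<rho> (cuntz_monomial \<mu>)) * (d * d ^ length \<mu>)"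
      by (simp only: comm mult.assoc)
    finally show ?case by (simp add: amplify_mult[OF T] cuntz_monomial_Cons)
  qed
  have "d ^ k * (star (d ^ k) * x) = x" for k x
    using unitary_elt_power[OF d, of k] by (simp add: unitary_elt_def flip: mult.assoc)
  then show ?thesis
    by (simp add: hom mono len star_mult mult.assoc amplify_star[OF T] flip: amplify_mult[OF T])
qed

lemma amplify_monomials_F2:
  assumes "length \<mu> = length \<nu>"
  shows "amplify I cuntz_monomial (cuntz_monomial \<mu> * star (cuntz_monomial \<nu>)) \<in> F2"
  unfolding amplify_def
proof (rule F2_sum)
  fix \<alpha>
  have "cuntz_monomial (\<alpha> @ \<mu>) * star (cuntz_monomial (\<alpha> @ \<nu>)) \<in> F2"
    by (rule F2_monomial) (simp add: assms)
  then show "cuntz_monomial \<alpha> * (cuntz_monomial \<mu> * star (cuntz_monomial \<nu>)) * star (cuntz_monomial \<alpha>) \<in> F2"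
    by (simp add: cuntz_monomial_append star_mult mult.assoc)
qed

text \<open>The smallest complete prefix code with words of different lengths. Completeness makes its
  monomials an isometry system; the different lengths allow a permutation of them to leave \<open>\<F>\<^sub>2\<close>.\<close>

definition prefix_code :: "index list set" where
  "prefix_code = {[I1], [I2, I1], [I2, I2]}"

lemma isometry_system_prefix_code: "isometry_system prefix_code cuntz_monomial"
proof -
  note orth = cuntz_family_orthogonal[OF cuntz_family_S]
  have cancel: "star (cuntz_S i) * (cuntz_S j * x) = (if i = j then x else 0)" for i j x
    using orth[of i j] by (simp flip: mult.assoc)
  have sum: "cuntz_S I1 * star (cuntz_S I1) + cuntz_S I2 * star (cuntz_S I2) = 1"
    using cuntz_family_S by (simp add: cuntz_family_def)
  have "cuntz_S I2 * (cuntz_S I1 * (star (cuntz_S I1) * star (cuntz_S I2))) +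
      cuntz_S I2 * (cuntz_S I2 * (star (cuntz_S I2) * star (cuntz_S I2)))
    = cuntz_S I2 * (cuntz_S I1 * star (cuntz_S I1) + cuntz_S I2 * star (cuntz_S I2)) * star (cuntz_S I2)"
    by (simp only: distrib_left distrib_right mult.assoc)
  then have "cuntz_S I1 * star (cuntz_S I1) +
      (cuntz_S I2 * (cuntz_S I1 * (star (cuntz_S I1) * star (cuntz_S I2))) +
      cuntz_S I2 * (cuntz_S I2 * (star (cuntz_S I2) * star (cuntz_S I2)))) = 1"
    by (simp add: sum)
  then show ?thesis
    by (auto simp: isometry_system_def prefix_code_def cuntz_monomial_def star_mult mult.assoc orth cancel)
qed

theorem corollary3p7:
  shows "\<exists>v :: cuntz2. unitary_elt v \<and> cuntz_endo v ` F2 \<subseteq> F2 \<and> v \<notin> F2"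
proof -
  let ?T = cuntz_monomial
  let ?\<rho> = "amplify prefix_code ?T"
  note T = isometry_system_prefix_code
  define \<sigma> where "\<sigma> = Transposition.transpose [I1] [I2, I1]"
  have code: "[I1] \<in> prefix_code" "[I2, I1] \<in> prefix_code" by (simp_all add: prefix_code_def)
  have \<sigma>: "\<sigma> ` prefix_code = prefix_code"
    by (auto simp: \<sigma>_def prefix_code_def Transposition.transpose_def)
  then have bij: "bij_betw \<sigma> prefix_code prefix_code"
    by (simp add: bij_betw_def \<sigma>_def)
  define d where "d = perm_unitary prefix_code ?T \<sigma>"
  have d: "unitary_elt d" "d * ?T [I2, I1] = ?T [I1]" "d * ?\<rho> x = ?\<rho> x * d" for x
    unfolding d_def
    using unitary_perm_unitary[OF T bij] perm_unitary_isometry[OF T code(2), of \<sigma>]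
      perm_unitary_commute[OF T, of \<sigma>] \<sigma>
    by (simp_all add: \<sigma>_def)
  obtain u where u: "unitary_elt u" "\<And>i. u * cuntz_S i = ?\<rho> (cuntz_S i)"
    using cuntz_family_unitary[OF cuntz_family_amplify[OF T cuntz_family_S]] by blast
  define v where "v = d * u"
  have v: "unitary_elt v" unfolding v_def by (rule unitary_elt_mult[OF d(1) u(1)])
  have vS: "v * cuntz_S i = d * ?\<rho> (cuntz_S i)" for i
    by (simp add: v_def mult.assoc u(2))
  have "cuntz_endo v ` F2 \<subseteq> F2"
    by (rule F2_invariant[OF cuntz_endo(1)[OF v]])
      (simp add: cuntz_endo_twisted_eq_amplify[OF T d(1) v d(3) vS] amplify_monomials_F2)
  moreover have "v \<notin> F2"
  proof
    assume "v \<in> F2"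
    let ?\<gamma> = "cuntz_endo (- 1)"
    have "unitary_elt (- 1 :: cuntz2)" by (simp add: unitary_elt_def star_minus)
    note \<gamma> = cuntz_endo[OF this]
    have hom: "?\<gamma> (x * y) = ?\<gamma> x * ?\<gamma> y" "?\<gamma> (star x) = star (?\<gamma> x)" for x y
      using \<gamma>(1) by (auto simp: unital_star_hom_def)
    have iso: "star (cuntz_S I1) * (cuntz_S I1 * x) = x" for x
      using cuntz_family_S by (simp add: cuntz_family_def isometry_elt_def flip: mult.assoc)
    \<comment> \<open>An element \<open>v\<close> of degree zero would make the left-hand side \<open>v S\<^sub>1 T\<^sub>2\<close> of degree
      three, while the right-hand side \<open>d T\<^sub>2 S\<^sub>1 = T\<^sub>1 S\<^sub>1\<close> has degree two.\<close>
    have "v * cuntz_S I1 * ?T [I2, I1] = d * ?T [I2, I1] * cuntz_S I1"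
      by (simp add: vS mult.assoc amplify_mult_isometry[OF T code(2)])
    then have "v * cuntz_S I1 * (cuntz_S I2 * cuntz_S I1) = cuntz_S I1 * cuntz_S I1"
      by (simp add: d(2)) (simp add: cuntz_monomial_def)
    then have eq: "star (cuntz_S I1) * (v * cuntz_S I1 * (cuntz_S I2 * cuntz_S I1)) = cuntz_S I1"
      by (simp add: iso)
    have "- cuntz_S I1 = ?\<gamma> (star (cuntz_S I1) * (v * cuntz_S I1 * (cuntz_S I2 * cuntz_S I1)))"
      unfolding eq by (simp add: \<gamma>(2))
    also have "\<dots> = star (cuntz_S I1) * (v * cuntz_S I1 * (cuntz_S I2 * cuntz_S I1))"
      by (simp add: hom \<gamma>(2) gauge_involution_F2[OF \<open>v \<in> F2\<close>] star_minus)
    also have "\<dots> = cuntz_S I1" by (rule eq)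
    finally have "2 *\<^sub>R cuntz_S I1 = 0" by (simp add: scaleR_2 eq_neg_iff_add_eq_0 neg_eq_iff_add_eq_0)
    then have "cuntz_S I1 = 0" by simp
    then show False using iso[of 1] by simp
  qed
  ultimately show ?thesis using v by blast
qed

end
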